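(* Let $\mathcal{G}$ be a finite game, let $x^*\in\mathcal{X}$, and let $x(t)=Q(y(t))$ where $y(t)$ solves $\dot y_k=v_k(Q(y))$, $k\in\mathcal{N}$. (I) If $x^*$ is stationary, then it is a Nash equilibrium of $\mathcal{G}$; conversely, if $x^*$ is a Nash equilibrium of $\mathcal{G}$ and $x^*\in\operatorname{im}Q$, then $x^*$ is stationary. (II) If $\lim_{t\to\infty}x(t)=x^*$, then $x^*$ is a Nash equilibrium of $\mathcal{G}$. (III) If $x^*$ is Lyapunov stable, then $x^*$ is a Nash equilibrium of $\mathcal{G}$. (IV) If $x^*$ is a strict Nash equilibrium of $\mathcal{G}$, then it is asymptotically stable.
   Context: Setting: finite game $\mathcal{G}$ with players $\mathcal{N}$, action sets $\mathcal{A}_k$, mixed strategies $\mathcal{X}_k=\Delta(\mathcal{A}_k)$, $\mathcal{X}=\prod_k\mathcal{X}_k$, multilinear expected payoffs $u_k$, payoff vectors $v_k(x)=(u_k(\alpha;x_{-k}))_{\alpha\in\mathcal{A}_k}$. Each player has a penalty function $h_k$ on $\mathcal{X}_k$ (continuous, $C^\infty$ on relative interiors of faces, strongly convex: $h(tx_1+(1-t)x_2)\le th(x_1)+(1-t)h(x_2)-\tfrac12Kt(1-t)\|x_1-x_2\|^2$, $K>0$), with choice map $Q_k(y_k)=\arg\max_{x_k\in\mathcal{X}_k}\{\langle y_k,x_k\rangle-h_k(x_k)\}$; $Q=(Q_k)_k$. Orbits are $x(t)=Q(y(t))$ for solutions $y(t)$ of the dynamics. $x^*$ is: stationary if $x^*\in\operatorname{im}Q$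 and every orbit with $x(0)=x^*$ satisfies $x(t)=x^*$ for all $t\ge0$; Lyapunov stable if for every neighborhood $U$ of $x^*$ in $\mathcal{X}$ there is a neighborhood $V$ such that every orbit with $x(0)\in V\cap\operatorname{im}Q$ stays in $U$ for all $t\ge0$; attracting if it has a neighborhood $V$ such that every orbit with $x(0)\in V\cap\operatorname{im}Q$ converges to $x^*$; asymptotically stable if Lyapunov stable and attracting. $x^*$ is a Nash equilibrium if $u_k(x^* )\ge u_k(x_k;x^*_{-k})$ for all $x_k\in\mathcal{X}_k$, $k\in\mathcal{N}$; strict if the inequality is strict for all $x_k\ne x_k^*$. *)

theory Defs
  imports "HOL-Analysis.Analysis"
begin

text \<open>Finite game: players form the finite type 'n, actions are drawn from the finite
  type 'a; player k has action set A k (a nonempty subset of 'a).  Pure payoffs are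
  pay k \<sigma> for pure profiles \<sigma> with \<sigma> j \<in> A j.  A mixed strategy of player k is a vector
  in real^'a supported on A k; a profile is an element of real^'a^'n.  Payoff
  vectors y_k also live in real^'a (coordinates outside A k are irrelevant).\<close>

definition strategies :: "'a set \<Rightarrow> (real^'a::finite) set" where
  "strategies Ak = {p. (\<forall>\<alpha>. 0 \<le> p $ \<alpha>) \<and> (\<forall>\<alpha>. \<alpha> \<notin> Ak \<longrightarrow> p $ \<alpha> = 0) \<and> (\<Sum>\<alpha>\<in>Ak. p $ \<alpha>) = 1}"

definition profiles :: "('n::finite \<Rightarrow> 'a::finite set) \<Rightarrow> (real^'a^'n) set" where
  "profiles A = {x. \<forall>k. x $ k \<in> strategies (A k)}"

definition payoff :: "('n::finite \<Rightarrow> 'a::finite set) \<Rightarrow> ('n \<Rightarrow> ('n \<Rightarrow> 'a) \<Rightarrow> real)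
    \<Rightarrow> 'n \<Rightarrow> real^'a^'n \<Rightarrow> real" where
  "payoff A pay k x = (\<Sum>\<sigma>\<in>PiE UNIV A. pay k \<sigma> * (\<Prod>j\<in>UNIV. x $ j $ (\<sigma> j)))"

definition deviate :: "real^'a^'n \<Rightarrow> 'n \<Rightarrow> real^'a \<Rightarrow> real^'a^'n" where
  "deviate x k p = (\<chi> j. if j = k then p else x $ j)"

definition pure :: "'a \<Rightarrow> real^'a::finite" where
  "pure \<alpha> = (\<chi> \<beta>. if \<beta> = \<alpha> then 1 else 0)"

definition payvec :: "('n::finite \<Rightarrow> 'a::finite set) \<Rightarrow> ('n \<Rightarrow> ('n \<Rightarrow> 'a) \<Rightarrow> real)
    \<Rightarrow> real^'a^'n \<Rightarrow> real^'a^'n" where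
  "payvec A pay x = (\<chi> k. \<chi> \<alpha>. if \<alpha> \<in> A k then payoff A pay k (deviate x k (pure \<alpha>)) else 0)"

definition nash :: "('n::finite \<Rightarrow> 'a::finite set) \<Rightarrow> ('n \<Rightarrow> ('n \<Rightarrow> 'a) \<Rightarrow> real)
    \<Rightarrow> real^'a^'n \<Rightarrow> bool" where
  "nash A pay x \<longleftrightarrow> x \<in> profiles A \<and>
     (\<forall>k. \<forall>p\<in>strategies (A k). payoff A pay k (deviate x k p) \<le> payoff A pay k x)"

definition strict_nash :: "('n::finite \<Rightarrow> 'a::finite set) \<Rightarrow> ('n \<Rightarrow> ('n \<Rightarrow> 'a) \<Rightarrow> real)
    \<Rightarrow> real^'a^'n \<Rightarrow> bool" where
  "strict_nash A pay x \<longleftrightarrow> x \<in> profiles A \<and>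
     (\<forall>k. \<forall>p\<in>strategies (A k). p \<noteq> x $ k \<longrightarrow> payoff A pay k (deviate x k p) < payoff A pay k x)"

text \<open>C-infinity on an open set: all iterated partial derivatives exist and are
  continuous.  D l is the partial derivative along the coordinate list l
  (D (i # l) is the partial derivative in direction i of D l).\<close>
definition smooth_on :: "(real^'a::finite) set \<Rightarrow> (real^'a \<Rightarrow> real) \<Rightarrow> bool" where
  "smooth_on S g \<longleftrightarrow> open S \<and> (\<exists>D :: 'a list \<Rightarrow> real^'a \<Rightarrow> real.
      (\<forall>x\<in>S. D [] x = g x) \<and>
      (\<forall>l. continuous_on S (D l)) \<and>
      (\<forall>l i. \<forall>x\<in>S. ((\<lambda>t. D l (x + t *\<^sub>R axis i 1)) has_real_derivative D (i # l) x) (at 0)))"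

definition smooth_on_rel_interior :: "(real^'a::finite) set \<Rightarrow> (real^'a \<Rightarrow> real) \<Rightarrow> bool" where
  "smooth_on_rel_interior F h \<longleftrightarrow>
     (\<exists>S g. rel_interior F \<subseteq> S \<and> smooth_on S g \<and> (\<forall>x\<in>rel_interior F. g x = h x))"

definition strongly_convex_on :: "(real^'a::finite) set \<Rightarrow> (real^'a \<Rightarrow> real) \<Rightarrow> bool" where
  "strongly_convex_on X h \<longleftrightarrow> (\<exists>K>0. \<forall>x1\<in>X. \<forall>x2\<in>X. \<forall>t\<in>{0..1}.
      h (t *\<^sub>R x1 + (1 - t) *\<^sub>R x2) \<le> t * h x1 + (1 - t) * h x2 - K * t * (1 - t) * (norm (x1 - x2))\<^sup>2 / 2)"

definition penalty :: "'a set \<Rightarrow> (real^'a::finite \<Rightarrow> real) \<Rightarrow> bool" where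
  "penalty Ak h \<longleftrightarrow> continuous_on (strategies Ak) h \<and>
     (\<forall>F. F face_of strategies Ak \<longrightarrow> smooth_on_rel_interior F h) \<and>
     strongly_convex_on (strategies Ak) h"

definition choice :: "'a set \<Rightarrow> (real^'a::finite \<Rightarrow> real) \<Rightarrow> real^'a \<Rightarrow> real^'a" where
  "choice Ak h y = (THE p. p \<in> strategies Ak \<and>
      (\<forall>q\<in>strategies Ak. y \<bullet> q - h q \<le> y \<bullet> p - h p))"

definition Qmap :: "('n::finite \<Rightarrow> 'a::finite set) \<Rightarrow> ('n \<Rightarrow> real^'a \<Rightarrow> real)
    \<Rightarrow> real^'a^'n \<Rightarrow> real^'a^'n" where
  "Qmap A h y = (\<chi> k. choice (A k) (h k) (y $ k))"

definition is_solution :: "('n::finite \<Rightarrow> 'a::finite set) \<Rightarrow> ('n \<Rightarrow> ('n \<Rightarrow> 'a) \<Rightarrow> real)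
    \<Rightarrow> ('n \<Rightarrow> real^'a \<Rightarrow> real) \<Rightarrow> (real \<Rightarrow> real^'a^'n) \<Rightarrow> bool" where
  "is_solution A pay h y \<longleftrightarrow>
     (\<forall>t\<ge>0. (y has_vector_derivative payvec A pay (Qmap A h (y t))) (at t within {0..}))"

definition is_orbit :: "('n::finite \<Rightarrow> 'a::finite set) \<Rightarrow> ('n \<Rightarrow> ('n \<Rightarrow> 'a) \<Rightarrow> real)
    \<Rightarrow> ('n \<Rightarrow> real^'a \<Rightarrow> real) \<Rightarrow> (real \<Rightarrow> real^'a^'n) \<Rightarrow> bool" where
  "is_orbit A pay h x \<longleftrightarrow> (\<exists>y. is_solution A pay h y \<and> (\<forall>t\<ge>0. x t = Qmap A h (y t)))"

definition stationary where
  "stationary A pay h xs \<longleftrightarrow> xs \<in> range (Qmap A h) \<and>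
     (\<forall>x. is_orbit A pay h x \<and> x 0 = xs \<longrightarrow> (\<forall>t\<ge>0. x t = xs))"

text \<open>Neighbourhoods in X = profiles A are traces of open sets; since orbits lie in X,
  quantifying over open sets of the ambient space is the same.\<close>
definition lyapunov_stable where
  "lyapunov_stable A pay h xs \<longleftrightarrow>
     (\<forall>U. openin (top_of_set (profiles A)) U \<and> xs \<in> U \<longrightarrow>
        (\<exists>V. openin (top_of_set (profiles A)) V \<and> xs \<in> V \<and>
           (\<forall>x. is_orbit A pay h x \<and> x 0 \<in> V \<inter> range (Qmap A h) \<longrightarrow> (\<forall>t\<ge>0. x t \<in> U))))"

definition attracting where
  "attracting A pay h xs \<longleftrightarrow>
     (\<exists>V. openin (top_of_set (profiles A)) V \<and> xs \<in> V \<and>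
        (\<forall>x. is_orbit A pay h x \<and> x 0 \<in> V \<inter> range (Qmap A h) \<longrightarrow> (x \<longlongrightarrow> xs) at_top))"

definition asymptotically_stable where
  "asymptotically_stable A pay h xs \<longleftrightarrow> lyapunov_stable A pay h xs \<and> attracting A pay h xs"

end

theory Submission
  imports Defs
begin

text \<open>Summing the penalties over the players turns \<open>Q\<close> into the regularised argmax of a single
  strongly convex function on the compact convex set of profiles, and makes Nash equilibria the
  solutions of the variational inequality \<open>v x \<bullet> (q - x) \<le> 0\<close>. Then \<open>Q\<close> is Lipschitz with dense
  image, so solutions exist globally and are unique. An orbit that eventually stays arbitrarily close
  to \<open>xs\<close> forces the variational inequality at \<open>xs\<close>, which covers stationary points, limits and
  stable points alike. If \<open>xs\<close> is a strict equilibrium, then \<open>v xs \<bullet> (q - xs)\<close> is bounded by a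
  negative multiple of \<open>norm (q - xs)\<close> because the profiles form a cone near \<open>xs\<close>; the Fenchel
  coupling is then a Lyapunov function, and the distance to \<open>xs\<close> decays like \<open>1 / t\<close>.\<close>

section \<open>Global Lipschitz differential equations\<close>

lemma real_derivative_le_imp_increment_le:
  fixes f :: "real \<Rightarrow> real"
  assumes "a \<le> b"
    and deriv: "\<And>s. s \<in> {a..b} \<Longrightarrow> (f has_real_derivative f' s) (at s within {a..b})"
    and bound: "\<And>s. s \<in> {a<..<b} \<Longrightarrow> f' s \<le> B"
  shows "f b - f a \<le> B * (b - a)"
proof (cases "a = b")
  case False
  then have "\<exists>s\<in>{a<..<b}. f b - f a = f' s * (b - a)"
    using \<open>a \<le> b\<close> deriv[unfolded has_field_derivative_def]
    by (intro mvt_simple) auto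
  then show ?thesis
    using bound \<open>a \<le> b\<close> by (metis diff_ge_0_iff_ge mult_right_mono)
qed simp

lemma has_vector_derivative_inner:
  assumes "(y has_vector_derivative y') (at s within S)"
  shows "((\<lambda>s. y s \<bullet> w) has_real_derivative (y' \<bullet> w)) (at s within S)"
  using bounded_linear.has_vector_derivative[OF bounded_linear_inner_left assms]
  by (simp add: has_real_derivative_iff_has_vector_derivative)

lemma indefinite_integral_has_vector_derivative:
  fixes f :: "real \<Rightarrow> 'e::euclidean_space"
  assumes "continuous_on {0..} f" "0 \<le> t"
  shows "((\<lambda>u. integral {0..u} f) has_vector_derivative f t) (at t within {0..})"
proof -
  have "((\<lambda>u. integral {0..u} f) has_vector_derivative f t) (at t within {0..t+1})"
    using assms by (intro integral_has_vector_derivative) (auto intro: continuous_on_subset)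
  moreover have "at t within {0..t+1} = at t within {0..}"
    by (rule at_within_nhd[of t "{..<t+1}"]) auto
  ultimately show ?thesis by simp
qed

text \<open>The integral of a bounded field grows at most linearly in \<open>t\<close>; this bound
  shows that the exponential weight absorbs the growth, so Picard iterates stay bounded.\<close>

lemma exp_weight_le:
  fixes L t :: real
  assumes "0 < L"
  shows "exp (- (L * t)) * t \<le> 1 / L"
proof -
  have "L * t \<le> exp (L * t)"
    using exp_ge_add_one_self[of "L * t"] by linarith
  then show ?thesis
    using assms by (simp add: exp_minus field_simps)
qed

text \<open>Picard iteration is a contraction on all of \<open>[0, \<infinity>)\<close> at once in the norm weighted by
  \<open>exp (- 2 L t)\<close>, which gives the global solution without any continuation argument.\<close>

lemma lipschitz_bounded_ode_exists:
  fixes F :: "'e::euclidean_space \<Rightarrow> 'e"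
  assumes L: "0 < L" and lip: "\<And>x y. norm (F x - F y) \<le> L * norm (x - y)"
    and bd: "\<And>x. norm (F x) \<le> M"
  obtains y where "y 0 = y0"
    "\<And>t. 0 \<le> t \<Longrightarrow> (y has_vector_derivative F (y t)) (at t within {0..})"
proof -
  \<comment> \<open>Integrating \<open>L * exp (l * s)\<close> produces the factor
    \<open>L / l\<close>, and this rate makes it \<open>1/2\<close>, the contraction
    constant.\<close>
  define l where "l = 2 * L"
  have l: "0 < l" using L by (simp add: l_def)
  have M: "0 \<le> M" using bd[of 0] norm_ge_zero order_trans by blast
  have "L-lipschitz_on UNIV F"
    using lip L by (intro lipschitz_onI) (auto simp: dist_norm)
  then have contF: "continuous_on UNIV F" by (rule lipschitz_on_continuous_on)
  \<comment> \<open>The unknown is the weighted displacement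
    \<open>z t = exp (- (l * t)) *\<^sub>R (y t - y0)\<close>; \<open>G z\<close> is the field along
    the curve that \<open>z\<close> encodes.\<close>
  define G where "G z s = F (y0 + exp (l * s) *\<^sub>R apply_bcontfun z s)" for z s
  have contG: "continuous_on S (G z)" for z S
    unfolding G_def
    by (intro continuous_on_compose2[OF contF] continuous_intros) auto
  have intG: "G z integrable_on {0..m}" for z m
    by (intro integrable_continuous_real contG)
  define P where "P z t = exp (- (l * t)) *\<^sub>R integral {0..t} (G z)" for z t
  \<comment> \<open>Bounded continuous functions live on the whole real line, so the iterate is
    extended to negative times by its value at \<open>0\<close>.\<close>
  define T where "T z = (\<lambda>t. P z (max 0 t))" for z
  have T_bcontfun: "T z \<in> bcontfun" for z
  proof (rule bcontfun_normI)
    have "continuous_on {0..} (\<lambda>u. integral {0..u} (G z))"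
      unfolding continuous_on_eq_continuous_within
      by (intro ballI has_vector_derivative_continuous[OF
            indefinite_integral_has_vector_derivative[OF contG]]) simp
    then have "continuous_on {0..} (P z)"
      unfolding P_def by (intro continuous_intros)
    then show "continuous_on UNIV (T z)"
      unfolding T_def by (rule continuous_on_compose2) (auto intro!: continuous_intros)
    show "norm (T z t) \<le> M / l" for t
    proof -
      define m where "m = max 0 t"
      have "norm (integral {0..m} (G z)) \<le> M * (m - 0)"
        by (rule integral_bound) (auto simp: m_def G_def bd intro!: contG[unfolded G_def])
      then have "norm (T z t) \<le> exp (- (l * m)) * (M * m)"
        by (simp add: T_def P_def m_def[symmetric])
      also have "\<dots> = M * (exp (- (l * m)) * m)" by simp
      also have "\<dots> \<le> M * (1 / l)"
        using exp_weight_le[OF l] M by (intro mult_left_mono)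
      finally show ?thesis by simp
    qed
  qed
  define \<Phi> where "\<Phi> z = Bcontfun (T z)" for z
  have app: "apply_bcontfun (\<Phi> z) = T z" for z
    unfolding \<Phi>_def by (rule Bcontfun_inverse[OF T_bcontfun])
  have contr: "dist (\<Phi> z) (\<Phi> w) \<le> 1/2 * dist z w" for z w
  proof (rule dist_bound)
    fix t :: real
    define m where "m = max 0 t"
    have m: "0 \<le> m" by (simp add: m_def)
    define d where "d = dist z w"
    have hi: "((\<lambda>s. L * d * exp (l * s)) has_integral (d/2 * exp (l * m) - d/2 * exp (l * 0))) {0..m}"
      using l unfolding l_def
      by (intro fundamental_theorem_of_calculus m)
         (auto intro!: derivative_eq_intros simp flip: has_real_derivative_iff_has_vector_derivative)
    have "norm (integral {0..m} (\<lambda>s. G z s - G w s)) \<le> integral {0..m} (\<lambda>s. L * d * exp (l * s))"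
    proof (rule integral_norm_bound_integral)
      show "(\<lambda>s. G z s - G w s) integrable_on {0..m}" by (intro integrable_diff intG)
      show "(\<lambda>s. L * d * exp (l * s)) integrable_on {0..m}" using hi by blast
      fix s assume "s \<in> {0..m}"
      have "norm (G z s - G w s) \<le> L * norm (exp (l * s) *\<^sub>R (apply_bcontfun z s - apply_bcontfun w s))"
        unfolding G_def by (rule order_trans[OF lip]) (simp add: scaleR_diff_right)
      also have "\<dots> = L * (exp (l * s) * dist (apply_bcontfun z s) (apply_bcontfun w s))"
        by (simp add: dist_norm)
      also have "\<dots> \<le> L * (exp (l * s) * d)"
        using L dist_bounded[of z s w] unfolding d_def by (intro mult_left_mono) auto
      finally show "norm (G z s - G w s) \<le> L * d * exp (l * s)" by (simp add: mult_ac)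
    qed
    also have "\<dots> = d/2 * exp (l * m) - d/2"
      using integral_unique[OF hi] by (simp only: mult_zero_right exp_zero mult_1_right)
    also have "\<dots> \<le> d/2 * exp (l * m)" by (simp add: d_def)
    finally have "norm (integral {0..m} (\<lambda>s. G z s - G w s)) \<le> d/2 * exp (l * m)" .
    moreover have "dist (T z t) (T w t) = exp (- (l * m)) * norm (integral {0..m} (\<lambda>s. G z s - G w s))"
      by (simp add: T_def P_def m_def[symmetric] dist_norm integral_diff[OF intG intG]
          flip: scaleR_diff_right)
    ultimately have "dist (T z t) (T w t) \<le> exp (- (l * m)) * (d/2 * exp (l * m))"
      by simp
    also have "\<dots> = d/2" by (simp add: exp_minus)
    finally show "dist (apply_bcontfun (\<Phi> z) t) (apply_bcontfun (\<Phi> w) t) \<le> 1/2 * dist z w"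
      by (simp add: app d_def)
  qed
  have "\<exists>!z. \<Phi> z = z"
    using contr by (intro banach_fix_type[where c = "1/2"]) auto
  then obtain z where z: "\<Phi> z = z" by auto
  define y where "y t = y0 + exp (l * t) *\<^sub>R apply_bcontfun z t" for t
  have y_eq: "y t = y0 + integral {0..t} (G z)" if "0 \<le> t" for t
  proof -
    have "apply_bcontfun z t = P z t"
      using app[of z] that by (simp add: z T_def)
    then show ?thesis by (simp add: y_def P_def exp_minus)
  qed
  show thesis
  proof
    show "y 0 = y0" using y_eq[of 0] by simp
    fix t :: real assume t: "0 \<le> t"
    have "((\<lambda>t. y0 + integral {0..t} (G z)) has_vector_derivative (G z t)) (at t within {0..})"
      using has_vector_derivative_add[OF has_vector_derivative_const
          indefinite_integral_has_vector_derivative[OF contG t]] by simp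
    then have "(y has_vector_derivative (G z t)) (at t within {0..})"
      by (rule has_vector_derivative_transform[rotated 2]) (use t y_eq in auto)
    then show "(y has_vector_derivative F (y t)) (at t within {0..})"
      by (simp add: G_def y_def)
  qed
qed

text \<open>Gronwall's argument: the squared distance of the two solutions times
  \<open>exp (- (2 * L * s))\<close> has nonpositive derivative, hence never exceeds its initial
  value zero.\<close>

lemma lipschitz_ode_unique:
  fixes F :: "'e::euclidean_space \<Rightarrow> 'e"
  assumes lip: "\<And>x y. norm (F x - F y) \<le> L * norm (x - y)"
    and y: "\<And>t. 0 \<le> t \<Longrightarrow> (y has_vector_derivative F (y t)) (at t within {0..})"
    and z: "\<And>t. 0 \<le> t \<Longrightarrow> (z has_vector_derivative F (z t)) (at t within {0..})"
    and "y 0 = z 0" "0 \<le> t"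
  shows "y t = z t"
proof -
  define w where "w s = y s - z s" for s
  define f where "f s = exp (- (2 * L * s)) * (w s \<bullet> w s)" for s
  define f' where "f' s = exp (- (2 * L * s)) * (2 * (w s \<bullet> (F (y s) - F (z s))) - 2 * L * (w s \<bullet> w s))" for s
  have "f t - f 0 \<le> 0 * (t - 0)"
  proof (rule real_derivative_le_imp_increment_le)
    fix s assume s: "s \<in> {0..t}"
    have "(w has_vector_derivative (F (y s) - F (z s))) (at s within {0..})"
      unfolding w_def using s by (intro has_vector_derivative_diff y z) auto
    then have "(w has_vector_derivative (F (y s) - F (z s))) (at s within {0..t})"
      by (rule has_vector_derivative_within_subset) auto
    then have "(w has_derivative (\<lambda>h. h *\<^sub>R (F (y s) - F (z s)))) (at s within {0..t})"
      by (simp add: has_vector_derivative_def)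
    from has_derivative_inner[OF this this]
    have "((\<lambda>s. w s \<bullet> w s) has_real_derivative (2 * (w s \<bullet> (F (y s) - F (z s))))) (at s within {0..t})"
      unfolding has_field_derivative_def
      by (rule has_derivative_eq_rhs) (auto simp: inner_commute)
    then show "(f has_real_derivative f' s) (at s within {0..t})"
      unfolding f_def[abs_def] f'_def
      by (auto intro!: derivative_eq_intros simp: algebra_simps)
  next
    fix s
    have "w s \<bullet> (F (y s) - F (z s)) \<le> norm (w s) * (L * norm (w s))"
      using norm_cauchy_schwarz[of "w s" "F (y s) - F (z s)"] lip[of "y s" "z s"]
      unfolding w_def by (meson mult_left_mono norm_ge_zero order_trans)
    then show "f' s \<le> 0"
      unfolding f'_def by (simp add: mult_le_0_iff dot_square_norm power2_eq_square mult_ac)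
  qed (use \<open>0 \<le> t\<close> in auto)
  moreover have "f 0 = 0" using \<open>y 0 = z 0\<close> by (simp add: f_def w_def)
  ultimately have "w t \<bullet> w t \<le> 0"
    by (simp add: f_def mult_le_0_iff)
  then have "w t = 0" by (metis antisym inner_eq_zero_iff inner_ge_zero)
  then show ?thesis by (simp add: w_def)
qed

section \<open>Regularised learning on a compact convex set\<close>

text \<open>Divide by \<open>t\<close> and let \<open>t\<close> tend to \<open>0\<close>. This
  extracts first-order conditions from optimality along a segment.\<close>

lemma nonpos_if_le_square:
  fixes a b :: real
  assumes "\<And>t. 0 < t \<Longrightarrow> t < 1 \<Longrightarrow> t * a \<le> t\<^sup>2 * b"
  shows "a \<le> 0"
proof (rule ccontr)
  assume "\<not> a \<le> 0"
  \<comment> \<open>The second bound makes \<open>t * (\<bar>b\<bar> + 1)\<close> at most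
    \<open>a / 2\<close>; the first keeps \<open>t\<close> below \<open>1\<close>.\<close>
  define t where "t = min (1/2) (a / (2 * (\<bar>b\<bar> + 1)))"
  have t: "0 < t" "t < 1" using \<open>\<not> a \<le> 0\<close> by (auto simp: t_def)
  have "t * a \<le> t * (t * b)" using assms[OF t] by (simp add: power2_eq_square mult_ac)
  then have "a \<le> t * b" using t by simp
  also have "\<dots> \<le> t * (\<bar>b\<bar> + 1)" using t by (intro mult_left_mono) auto
  also have "\<dots> \<le> a / (2 * (\<bar>b\<bar> + 1)) * (\<bar>b\<bar> + 1)"
    unfolding t_def by (intro mult_right_mono) auto
  also have "\<dots> = a / 2" by (simp add: field_simps)
  finally show False using \<open>\<not> a \<le> 0\<close> by simp
qed

text \<open>The product structure of the game is forgotten: \<open>H\<close> stands for the total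
  penalty, \<open>v\<close> for the payoff field, and a single score vector in the ambient space
  drives all players at once.\<close>

locale regularized_learning =
  fixes X :: "'e::euclidean_space set" and H :: "'e \<Rightarrow> real" and K L :: real
    and Q v :: "'e \<Rightarrow> 'e"
  assumes compact_X: "compact X" and convex_X: "convex X"
    and cont_H: "continuous_on X H" and K_pos: "0 < K" and L_pos: "0 < L"
    and strong: "\<And>p q t. \<lbrakk>p \<in> X; q \<in> X; 0 \<le> t; t \<le> 1\<rbrakk> \<Longrightarrow>
      H (t *\<^sub>R p + (1 - t) *\<^sub>R q) \<le> t * H p + (1 - t) * H q - K * t * (1 - t) * (norm (p - q))\<^sup>2 / 2"
    and Q_in: "\<And>y. Q y \<in> X"
    and Q_max: "\<And>y q. q \<in> X \<Longrightarrow> y \<bullet> q - H q \<le> y \<bullet> Q y - H (Q y)"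
    and v_lip: "\<And>x x'. \<lbrakk>x \<in> X; x' \<in> X\<rbrakk> \<Longrightarrow> norm (v x - v x') \<le> L * norm (x - x')"
begin

definition solves :: "(real \<Rightarrow> 'e) \<Rightarrow> bool" where
  "solves y \<longleftrightarrow> (\<forall>t\<ge>0. (y has_vector_derivative v (Q (y t))) (at t within {0..}))"

text \<open>The Stampacchia variational inequality for \<open>v\<close> on \<open>X\<close>, in the
  sign convention of maximisation.\<close>

definition variational_solution :: "'e \<Rightarrow> bool" where
  "variational_solution x \<longleftrightarrow> (\<forall>q\<in>X. v x \<bullet> (q - x) \<le> 0)"

section \<open>Bounds on the feasible set and regularity of the choice map\<close>

lemma convex_comb_in: "\<lbrakk>p \<in> X; q \<in> X; 0 \<le> t; t \<le> 1\<rbrakk> \<Longrightarrow> t *\<^sub>R p + (1 - t) *\<^sub>R q \<in> X"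
  using convexD[OF convex_X, of p q t "1 - t"] by simp

lemma H_bounded: obtains C where "0 < C" "\<And>x. x \<in> X \<Longrightarrow> \<bar>H x\<bar> \<le> C"
  using compact_imp_bounded[OF compact_continuous_image[OF cont_H compact_X]]
  unfolding bounded_pos by auto

lemma X_diameter: obtains D where "0 < D" "\<And>x y. x \<in> X \<Longrightarrow> y \<in> X \<Longrightarrow> norm (x - y) \<le> D"
proof -
  obtain B where B: "0 < B" "\<And>x. x \<in> X \<Longrightarrow> norm x \<le> B"
    using compact_imp_bounded[OF compact_X] unfolding bounded_pos by auto
  show thesis
  proof (rule that[of "2 * B"])
    show "norm (x - y) \<le> 2 * B" if "x \<in> X" "y \<in> X" for x y
      using norm_triangle_ineq4[of x y] B(2)[OF that(1)] B(2)[OF that(2)] by linarith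
  qed (use B in simp)
qed

text \<open>Compare \<open>Q y\<close> with points of the segment towards \<open>q\<close> and let
  them approach \<open>Q y\<close>: the quadratic gain of strong convexity survives in full to first
  order.\<close>

lemma Q_strong_max:
  assumes q: "q \<in> X"
  shows "y \<bullet> q - H q + K / 2 * (norm (q - Q y))\<^sup>2 \<le> y \<bullet> Q y - H (Q y)"
proof -
  define x where "x = Q y"
  define d where "d = K / 2 * (norm (q - x))\<^sup>2"
  have "(y \<bullet> q - H q + d) - (y \<bullet> x - H x) \<le> 0"
  proof (rule nonpos_if_le_square)
    fix t :: real assume t: "0 < t" "t < 1"
    have x: "x \<in> X" by (simp add: x_def Q_in)
    have "y \<bullet> (t *\<^sub>R q + (1 - t) *\<^sub>R x) - H (t *\<^sub>R q + (1 - t) *\<^sub>R x) \<le> y \<bullet> x - H x"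
      unfolding x_def using Q_max convex_comb_in[OF q] Q_in t by simp
    moreover have "H (t *\<^sub>R q + (1 - t) *\<^sub>R x) \<le> t * H q + (1 - t) * H x - t * (1 - t) * d"
      using strong[OF q x, of t] t by (simp add: d_def algebra_simps)
    ultimately show "t * ((y \<bullet> q - H q + d) - (y \<bullet> x - H x)) \<le> t\<^sup>2 * d"
      by (simp add: inner_add_right power2_eq_square algebra_simps)
  qed
  then show ?thesis by (simp add: d_def x_def)
qed

lemma Q_eqI:
  assumes p: "p \<in> X" and max: "\<And>q. q \<in> X \<Longrightarrow> y \<bullet> q - H q \<le> y \<bullet> p - H p"
  shows "Q y = p"
proof -
  have "K / 2 * (norm (p - Q y))\<^sup>2 \<le> 0"
    using Q_strong_max[OF p, of y] max[OF Q_in, of y] by simp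
  then show ?thesis using K_pos by (simp add: mult_le_0_iff)
qed

text \<open>Adding the strong maximality inequalities for \<open>y\<close> and for \<open>z\<close>
  cancels the penalties and leaves strong monotonicity; Cauchy-Schwarz does the rest.\<close>

lemma Q_lipschitz: "norm (Q y - Q z) \<le> norm (y - z) / K"
proof -
  define d where "d = norm (Q y - Q z)"
  have "K * d\<^sup>2 \<le> (y - z) \<bullet> (Q y - Q z)"
    using Q_strong_max[OF Q_in, of y z] Q_strong_max[OF Q_in, of z y]
    by (simp add: d_def norm_minus_commute algebra_simps)
  also have "\<dots> \<le> norm (y - z) * d" unfolding d_def by (rule norm_cauchy_schwarz)
  finally have "K * d * d \<le> norm (y - z) * d" by (simp add: power2_eq_square)
  then have "K * d \<le> norm (y - z)"
    by (cases "d = 0") (auto simp: d_def)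
  then show ?thesis using K_pos by (simp add: d_def field_simps)
qed

section \<open>Trajectories of the score dynamics\<close>

lemma field_lipschitz: "norm (v (Q y) - v (Q z)) \<le> L / K * norm (y - z)"
  using v_lip[OF Q_in Q_in, of y z] mult_left_mono[OF Q_lipschitz[of y z], of L] L_pos by simp

lemma solution_exists: obtains y where "solves y" "y 0 = y0"
proof -
  obtain D where D: "\<And>x y. x \<in> X \<Longrightarrow> y \<in> X \<Longrightarrow> norm (x - y) \<le> D" by (rule X_diameter) blast
  have bounded: "norm (v (Q y)) \<le> norm (v (Q 0)) + L * D" for y
    using norm_triangle_sub[of "v (Q y)" "v (Q 0)"] v_lip[OF Q_in Q_in, of y 0]
      mult_left_mono[OF D[OF Q_in Q_in, of y 0], of L] L_pos by linarith
  have "0 < L / K" using L_pos K_pos by simp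
  then obtain y where "y 0 = y0"
    "\<And>t. 0 \<le> t \<Longrightarrow> (y has_vector_derivative v (Q (y t))) (at t within {0..})"
    using lipschitz_bounded_ode_exists[of "L / K" "\<lambda>y. v (Q y)", OF _ field_lipschitz bounded]
    by blast
  then show thesis using that unfolding solves_def by blast
qed

text \<open>The vector \<open>w\<close> may be built from the choice at the endpoint
  \<open>b\<close>, since it is fixed during the integration. The bound is asked only strictly
  inside the interval, so that \<open>b\<close> may be a first exit time.\<close>

lemma solves_increment_le:
  assumes y: "solves y" and ab: "0 \<le> a" "a \<le> b"
    and B: "\<And>s. a < s \<Longrightarrow> s < b \<Longrightarrow> v (Q (y s)) \<bullet> w \<le> B"
  shows "(y b - y a) \<bullet> w \<le> B * (b - a)"
proof -
  have "y b \<bullet> w - y a \<bullet> w \<le> B * (b - a)"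
  proof (rule real_derivative_le_imp_increment_le)
    fix s assume "s \<in> {a..b}"
    then have "(y has_vector_derivative v (Q (y s))) (at s within {a..b})"
      using y ab unfolding solves_def
      by (intro has_vector_derivative_within_subset[of y _ s "{0..}" "{a..b}"]) auto
    then show "((\<lambda>s. y s \<bullet> w) has_real_derivative v (Q (y s)) \<bullet> w) (at s within {a..b})"
      by (rule has_vector_derivative_inner)
  qed (use ab B in auto)
  then show ?thesis by (simp add: inner_diff_left)
qed

lemma continuous_on_orbit:
  assumes "solves y" shows "continuous_on {0..} (\<lambda>t. Q (y t))"
proof -
  have "continuous_on {0..} y"
    using assms unfolding solves_def continuous_on_eq_continuous_within
    by (auto intro: has_vector_derivative_continuous)
  have "(1 / K)-lipschitz_on UNIV Q"
    using Q_lipschitz K_pos by (intro lipschitz_onI) (auto simp: dist_norm)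
  then have "continuous_on UNIV Q" by (rule lipschitz_on_continuous_on)
  then show ?thesis
    using \<open>continuous_on {0..} y\<close> by (rule continuous_on_compose2) simp
qed

text \<open>Were \<open>xs\<close> not a solution, some direction \<open>q\<close> would be uniformly profitable near \<open>xs\<close>, so an
  orbit trapped there would accumulate a linearly growing score for \<open>q\<close>, against the optimality of
  the choice.\<close>

lemma trapped_orbits_imp_variational_solution:
  assumes xs: "xs \<in> X"
    and trap: "\<And>e. 0 < e \<Longrightarrow> \<exists>y T. solves y \<and> 0 \<le> T \<and> (\<forall>t\<ge>T. dist (Q (y t)) xs < e)"
  shows "variational_solution xs"
  unfolding variational_solution_def
proof (rule ballI, rule ccontr)
  fix q assume q: "q \<in> X" and "\<not> v xs \<bullet> (q - xs) \<le> 0"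
  define c where "c = v xs \<bullet> (q - xs)"
  have c: "0 < c" using \<open>\<not> v xs \<bullet> (q - xs) \<le> 0\<close> by (simp add: c_def)
  obtain C where C: "0 < C" "\<And>x. x \<in> X \<Longrightarrow> \<bar>H x\<bar> \<le> C" by (rule H_bounded) blast
  obtain D where D: "0 < D" "\<And>x y. x \<in> X \<Longrightarrow> y \<in> X \<Longrightarrow> norm (x - y) \<le> D" by (rule X_diameter) blast
  \<comment> \<open>\<open>N\<close> dominates the coefficient of \<open>e\<close> in the errors
    below: replacing \<open>v xs\<close> by \<open>v x\<close> costs \<open>L * e * D\<close>, and
    replacing \<open>xs\<close> by \<open>x'\<close> costs \<open>norm (v xs) * e\<close>. The
    radius \<open>e\<close> keeps their sum within half of \<open>c\<close>.\<close>
  define N where "N = L * D + norm (v xs) + 1"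
  have N: "0 < N" using L_pos D(1) by (simp add: N_def add_nonneg_pos)
  define e where "e = c / (2 * N)"
  have e: "0 < e" "e * N = c / 2" using c N by (auto simp: e_def)
  \<comment> \<open>Two independent points: \<open>x\<close> is the choice at an intermediate time,
    where the field is evaluated, and \<open>x'\<close> is the choice at the final time, against
    which it is integrated.\<close>
  have near: "v x \<bullet> (x' - q) \<le> - (c / 2)"
    if "x \<in> X" "x' \<in> X" "dist x xs < e" "dist x' xs < e" for x x'
  proof -
    have "(v x - v xs) \<bullet> (x' - q) \<le> norm (v x - v xs) * norm (x' - q)"
      by (rule norm_cauchy_schwarz)
    also have "\<dots> \<le> (L * e) * D"
    proof (rule mult_mono)
      show "norm (v x - v xs) \<le> L * e"
        using v_lip[OF that(1) xs] mult_left_mono[of "norm (x - xs)" e L] that(3) L_pos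
        unfolding dist_norm by linarith
    qed (use D q that L_pos e in auto)
    finally have 1: "(v x - v xs) \<bullet> (x' - q) \<le> L * e * D" .
    have "v xs \<bullet> (x' - xs) \<le> norm (v xs) * norm (x' - xs)" by (rule norm_cauchy_schwarz)
    also have "\<dots> \<le> norm (v xs) * e" using that by (intro mult_left_mono) (auto simp: dist_norm)
    finally have 2: "v xs \<bullet> (x' - xs) \<le> norm (v xs) * e" .
    have "v x \<bullet> (x' - q) = (v x - v xs) \<bullet> (x' - q) + v xs \<bullet> (x' - xs) - c"
      by (simp add: c_def algebra_simps)
    then have "v x \<bullet> (x' - q) \<le> e * (L * D + norm (v xs)) - c"
      using 1 2 by (simp add: algebra_simps)
    also have "\<dots> \<le> e * N - c" using e by (simp add: N_def)
    finally show ?thesis using e by simp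
  qed
  obtain y T where y: "solves y" and T: "0 \<le> T" "\<And>t. T \<le> t \<Longrightarrow> dist (Q (y t)) xs < e"
    using trap[OF e(1)] by blast
  \<comment> \<open>Optimality of the final choice and the size of the score at \<open>T\<close>
    keep the increment of the score, tested against \<open>Q (y t) - q\<close>, at or above
    \<open>- E\<close>. The time \<open>t\<close> below is late enough for the drift to push it to
    \<open>- E - 1\<close>.\<close>
  define E where "E = 2 * C + norm (y T) * D"
  have E: "0 < E" using C D by (simp add: E_def add_pos_nonneg)
  define t where "t = T + 2 * (E + 1) / c"
  have tT: "T \<le> t" using E c by (simp add: t_def)
  have "(y t - y T) \<bullet> (Q (y t) - q) \<le> - (c / 2) * (t - T)"
    using T tT by (intro solves_increment_le near y) (auto simp: Q_in)
  moreover have "- (c / 2) * (t - T) = - E - 1" using c by (simp add: t_def field_simps)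
  moreover have "- (2 * C) \<le> y t \<bullet> (Q (y t) - q)"
    using Q_max[OF q, of "y t"] C(2)[OF q] C(2)[OF Q_in, of "y t"]
    unfolding inner_diff_right by linarith
  moreover have "y T \<bullet> (Q (y t) - q) \<le> norm (y T) * D"
    using norm_cauchy_schwarz[of "y T" "Q (y t) - q"] D(2)[OF Q_in q, of "y t"]
    by (meson mult_left_mono norm_ge_zero order_trans)
  ultimately show False by (simp add: inner_diff_left E_def)
qed

text \<open>The minimiser of \<open>H q + n/2 * (norm (q - x))\<^sup>2\<close> is the choice for the score \<open>n (x - q)\<close>,
  and it tends to \<open>x\<close> as \<open>n\<close> grows.\<close>

lemma range_Q_dense:
  assumes x: "x \<in> X" and e: "0 < e"
  shows "\<exists>y. dist (Q y) x < e"
proof -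
  obtain C where C: "0 < C" "\<And>x. x \<in> X \<Longrightarrow> \<bar>H x\<bar> \<le> C" by (rule H_bounded) blast
  \<comment> \<open>Then \<open>n / 2 * e\<^sup>2\<close> equals \<open>2 * C + 1/2\<close>, more
    than the \<open>2 * C\<close> that the minimiser \<open>p\<close> can afford by comparison with
    \<open>x\<close>.\<close>
  define n where "n = (4 * C + 1) / e\<^sup>2"
  have n: "0 < n" using C e by (simp add: n_def)
  define g where "g q = H q + n / 2 * (norm (q - x))\<^sup>2" for q
  have "continuous_on X g" unfolding g_def by (intro continuous_intros cont_H)
  then obtain p where p: "p \<in> X" and min: "\<And>q. q \<in> X \<Longrightarrow> g p \<le> g q"
    using continuous_attains_inf[OF compact_X] x by blast
  have "Q (n *\<^sub>R (x - p)) = p"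
  proof (rule Q_eqI[OF p])
    fix q assume q: "q \<in> X"
    \<comment> \<open>First-order optimality of \<open>p\<close>: convexity bounds \<open>H\<close>
      along the segment towards \<open>q\<close>, and the square expands exactly. Rearranged, this
      says that \<open>p\<close> is the choice for the score
      \<open>n *\<^sub>R (x - p)\<close>.\<close>
    have "H p - H q - n * ((p - x) \<bullet> (q - p)) \<le> 0"
    proof (rule nonpos_if_le_square)
      fix t :: real assume t: "0 < t" "t < 1"
      have "g p \<le> g (t *\<^sub>R q + (1 - t) *\<^sub>R p)"
        using t by (intro min convex_comb_in q p) auto
      moreover have "H (t *\<^sub>R q + (1 - t) *\<^sub>R p) \<le> t * H q + (1 - t) * H p"
      proof -
        have "0 \<le> K * t * (1 - t) * (norm (q - p))\<^sup>2 / 2" using t K_pos by simp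
        then show ?thesis using strong[OF q p, of t] t by linarith
      qed
      moreover have "(norm (t *\<^sub>R q + (1 - t) *\<^sub>R p - x))\<^sup>2 =
          (norm (p - x))\<^sup>2 + 2 * t * ((p - x) \<bullet> (q - p)) + t\<^sup>2 * (norm (q - p))\<^sup>2"
      proof -
        have "t *\<^sub>R q + (1 - t) *\<^sub>R p - x = (p - x) + t *\<^sub>R (q - p)" by (simp add: algebra_simps)
        then show ?thesis
          by (simp only: power2_norm_eq_inner)
             (simp add: inner_add_left inner_add_right inner_commute power2_eq_square)
      qed
      ultimately have "H p + n / 2 * (norm (p - x))\<^sup>2 \<le> t * H q + (1 - t) * H p + n / 2 *
          ((norm (p - x))\<^sup>2 + 2 * t * ((p - x) \<bullet> (q - p)) + t\<^sup>2 * (norm (q - p))\<^sup>2)"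
        unfolding g_def by simp
      then show "t * (H p - H q - n * ((p - x) \<bullet> (q - p))) \<le> t\<^sup>2 * (n / 2 * (norm (q - p))\<^sup>2)"
        by (simp only: ring_distribs left_diff_distrib right_diff_distrib) (simp add: mult_ac)
    qed
    then show "n *\<^sub>R (x - p) \<bullet> q - H q \<le> n *\<^sub>R (x - p) \<bullet> p - H p"
      by (simp add: algebra_simps)
  qed
  moreover have "norm (p - x) < e"
  proof (rule ccontr)
    assume "\<not> norm (p - x) < e"
    then have "n / 2 * e\<^sup>2 \<le> n / 2 * (norm (p - x))\<^sup>2"
      using n e by (intro mult_left_mono power_mono) auto
    also have "\<dots> \<le> 2 * C"
      using min[OF x] C(2)[OF x] C(2)[OF p] by (simp add: g_def)
    finally show False using e by (simp add: n_def)
  qed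
  ultimately show ?thesis by (intro exI[of _ "n *\<^sub>R (x - p)"]) (simp add: dist_norm)
qed

text \<open>The score need not rest: it moves on the line \<open>y 0 + t *\<^sub>R v xs\<close>.
  Adding nonnegative multiples of \<open>v xs\<close> keeps \<open>xs\<close> optimal, so this line
  solves the dynamics, and uniqueness identifies it with \<open>y\<close>.\<close>

lemma variational_solution_imp_constant_orbit:
  assumes xs: "variational_solution xs" and y: "solves y" and "Q (y 0) = xs" and "0 \<le> t"
  shows "Q (y t) = xs"
proof -
  define z where "z t = y 0 + t *\<^sub>R v xs" for t
  have Qz: "Q (z t) = xs" if "0 \<le> t" for t
  proof (rule Q_eqI)
    show "xs \<in> X" using Q_in \<open>Q (y 0) = xs\<close> by blast
    fix q assume q: "q \<in> X"
    then have "t * (v xs \<bullet> (q - xs)) \<le> 0"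
      using xs that by (simp add: variational_solution_def mult_nonneg_nonpos)
    then show "z t \<bullet> q - H q \<le> z t \<bullet> xs - H xs"
      using Q_max[OF q, of "y 0"] \<open>Q (y 0) = xs\<close> by (simp add: z_def algebra_simps)
  qed
  have z: "(z has_vector_derivative v (Q (z t))) (at t within {0..})" if "0 \<le> t" for t
    unfolding Qz[OF that] unfolding z_def by (auto intro!: derivative_eq_intros)
  have "y t = z t"
  proof (rule lipschitz_ode_unique[where F = "\<lambda>y. v (Q y)", OF field_lipschitz _ z])
    show "(y has_vector_derivative v (Q (y s))) (at s within {0..})" if "0 \<le> s" for s
      using y that unfolding solves_def by blast
  qed (use \<open>0 \<le> t\<close> in \<open>simp_all add: z_def\<close>)
  then show ?thesis using Qz[OF \<open>0 \<le> t\<close>] by simp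
qed

section \<open>Stability of strict solutions\<close>

text \<open>On the compact slice of \<open>X\<close> at distance \<open>r\<close> the loss has a
  positive minimum \<open>m\<close>. Every other point of \<open>X\<close> rescales to that slice,
  and linearity in \<open>q\<close> carries over the slope \<open>m / r\<close>.\<close>

lemma strict_solution_sharp:
  assumes r: "0 < r" and conic: "\<And>x. x \<in> X \<Longrightarrow> x \<noteq> xs \<Longrightarrow> xs + (r / norm (x - xs)) *\<^sub>R (x - xs) \<in> X"
    and strict: "\<And>q. q \<in> X \<Longrightarrow> q \<noteq> xs \<Longrightarrow> v xs \<bullet> (q - xs) < 0"
  obtains c where "0 < c" "\<And>q. q \<in> X \<Longrightarrow> v xs \<bullet> (q - xs) \<le> - c * norm (q - xs)"
proof (cases "X \<inter> sphere xs r = {}")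
  \<comment> \<open>An empty slice forces \<open>X\<close> to contain no point besides
    \<open>xs\<close>, and then any positive constant serves.\<close>
  case True
  have "q = xs" if "q \<in> X" for q
  proof (rule ccontr)
    assume "q \<noteq> xs"
    then have "xs + (r / norm (q - xs)) *\<^sub>R (q - xs) \<in> X \<inter> sphere xs r"
      using conic[OF that] r by (simp add: dist_norm)
    with True show False by blast
  qed
  then show thesis by (intro that[of 1]) auto
next
  case False
  have "compact (X \<inter> sphere xs r)" by (intro compact_Int compact_X compact_sphere)
  moreover have "continuous_on (X \<inter> sphere xs r) (\<lambda>q. v xs \<bullet> (q - xs))"
    by (intro continuous_intros)
  ultimately obtain p where p: "p \<in> X \<inter> sphere xs r"
    and max: "\<And>q. q \<in> X \<inter> sphere xs r \<Longrightarrow> v xs \<bullet> (q - xs) \<le> v xs \<bullet> (p - xs)"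
    using continuous_attains_sup[of "X \<inter> sphere xs r"] False by blast
  define m where "m = - (v xs \<bullet> (p - xs))"
  have "p \<noteq> xs" using p r by auto
  then have m: "0 < m" using strict[of p] p by (simp add: m_def)
  show thesis
  proof (rule that[of "m / r"])
    show "0 < m / r" using m r by simp
    fix q assume q: "q \<in> X"
    show "v xs \<bullet> (q - xs) \<le> - (m / r) * norm (q - xs)"
    proof (cases "q = xs")
      case False
      then have "xs + (r / norm (q - xs)) *\<^sub>R (q - xs) \<in> X \<inter> sphere xs r"
        using conic[OF q] r by (simp add: dist_norm)
      from max[OF this] have "r / norm (q - xs) * (v xs \<bullet> (q - xs)) \<le> - m"
        by (simp add: m_def)
      then show ?thesis using r False by (simp add: field_simps)
    qed simp
  qed
qed

text \<open>Within distance \<open>c / (2 * L)\<close> the field changes by at most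
  \<open>c / 2\<close>, which consumes half of the slope.\<close>

lemma strict_solution_locally_sharp:
  assumes xs: "xs \<in> X" and c: "0 < c" "\<And>q. q \<in> X \<Longrightarrow> v xs \<bullet> (q - xs) \<le> - c * norm (q - xs)"
    and x: "x \<in> X" "dist x xs < c / (2 * L)" and q: "q \<in> X"
  shows "v x \<bullet> (q - xs) \<le> - (c / 2) * norm (q - xs)"
proof -
  have "L * norm (x - xs) \<le> c / 2"
    using x(2) L_pos by (simp add: dist_norm field_simps)
  then have "norm (v x - v xs) \<le> c / 2" using v_lip[OF x(1) xs] by linarith
  then have "(v x - v xs) \<bullet> (q - xs) \<le> c / 2 * norm (q - xs)"
    by (meson mult_right_mono norm_cauchy_schwarz norm_ge_zero order_trans)
  then show ?thesis using c(2)[OF q] by (simp add: inner_diff_left)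
qed

text \<open>The supremum over \<open>q\<close> of the left-hand side is the Fenchel coupling of \<open>xs\<close> and \<open>y\<close>; the
  inequality obtained by pushing \<open>Q y\<close> away from \<open>xs\<close> to distance \<open>r\<close> controls it even though
  \<open>y\<close> may be arbitrarily large.\<close>

lemma fenchel_coupling_small:
  assumes xs: "xs \<in> X" and r: "0 < r"
    and conic: "\<And>x. x \<in> X \<Longrightarrow> x \<noteq> xs \<Longrightarrow> xs + (r / norm (x - xs)) *\<^sub>R (x - xs) \<in> X"
    and k: "0 < k"
  obtains \<eta> where "0 < \<eta>"
    "\<And>y q. dist (Q y) xs < \<eta> \<Longrightarrow> q \<in> X \<Longrightarrow> y \<bullet> (q - xs) - H q + H xs \<le> k"
proof -
  obtain C where C: "0 < C" "\<And>x. x \<in> X \<Longrightarrow> \<bar>H x\<bar> \<le> C" by (rule H_bounded) blast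
  obtain d where d: "0 < d" "\<And>x. x \<in> X \<Longrightarrow> dist x xs < d \<Longrightarrow> dist (H x) (H xs) < k / 2"
    using cont_H xs k unfolding continuous_on_iff by (metis half_gt_zero)
  \<comment> \<open>The three bounds control \<open>H xs - H x\<close> by \<open>k / 2\<close>,
    leave room \<open>r - n\<close> of at least \<open>r / 2\<close> for the push, and make
    \<open>2 * C * n\<close> at most \<open>k * r / 4\<close>, which yields
    \<open>a \<le> k / 2\<close>.\<close>
  define \<eta> where "\<eta> = min d (min (r / 2) (k * r / (8 * C)))"
  show thesis
  proof (rule that[of \<eta>])
    show "0 < \<eta>" using d r k C by (simp add: \<eta>_def)
    fix y q assume near: "dist (Q y) xs < \<eta>" and q: "q \<in> X"
    define x where "x = Q y"
    define n where "n = norm (x - xs)"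
    define a where "a = y \<bullet> (x - xs)"
    have x: "x \<in> X" by (simp add: x_def Q_in)
    have n: "n < d" "n < r / 2" "n < k * r / (8 * C)"
      using near by (auto simp: \<eta>_def n_def x_def dist_norm)
    have "a \<le> k / 2"
    proof (cases "a \<le> 0")
      case False
      then have "x \<noteq> xs" by (auto simp: a_def)
      then have n0: "0 < n" by (simp add: n_def)
      \<comment> \<open>Since \<open>u\<close> lies beyond \<open>x\<close> on the ray from
        \<open>xs\<close>, optimality of \<open>x\<close> against \<open>u\<close> bounds the score
        in the direction \<open>x - xs\<close> from above.\<close>
      define u where "u = xs + (r / n) *\<^sub>R (x - xs)"
      have u: "u \<in> X" unfolding u_def n_def by (rule conic[OF x \<open>x \<noteq> xs\<close>])
      have "y \<bullet> (u - x) \<le> 2 * C"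
        using Q_max[OF u, of y] C(2)[OF u] C(2)[OF x]
        unfolding x_def inner_diff_right by linarith
      moreover have "u - x = (r / n - 1) *\<^sub>R (x - xs)" by (simp add: u_def algebra_simps)
      ultimately have "(r / n - 1) * a \<le> 2 * C" by (simp add: a_def)
      then have "(r - n) * a \<le> 2 * C * n" using n0 by (simp add: field_simps)
      moreover have "r / 2 * a \<le> (r - n) * a" using n False by (intro mult_right_mono) auto
      moreover have "2 * C * n \<le> k * r / 4" using n C by (simp add: field_simps)
      ultimately have "r * a \<le> r * (k / 2)" by argo
      then show ?thesis using r by (rule mult_left_le_imp_le)
    qed (use k in simp)
    moreover have "H xs - H x \<le> k / 2"
      using d(2)[OF x] n(1) unfolding n_def dist_norm real_norm_def by linarith
    ultimately show "y \<bullet> (q - xs) - H q + H xs \<le> k"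
      using Q_max[OF q, of y] unfolding a_def x_def inner_diff_right by linarith
  qed
qed

text \<open>The coupling dominates \<open>K / 2\<close> times the squared distance: insert
  \<open>q = Q y\<close> and use strong maximality of \<open>Q y\<close> against
  \<open>xs\<close>.\<close>

lemma fenchel_coupling_controls_distance:
  assumes "xs \<in> X" and "\<And>q. q \<in> X \<Longrightarrow> y \<bullet> (q - xs) - H q + H xs \<le> K * d\<^sup>2 / 2" and "0 \<le> d"
  shows "dist (Q y) xs \<le> d"
proof -
  have "K / 2 * (norm (xs - Q y))\<^sup>2 \<le> K / 2 * d\<^sup>2"
    using Q_strong_max[OF assms(1), of y] assms(2)[OF Q_in, of y]
    by (simp add: inner_diff_right)
  then have "(norm (xs - Q y))\<^sup>2 \<le> d\<^sup>2" using K_pos by simp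
  then show ?thesis using \<open>0 \<le> d\<close> by (simp add: dist_norm norm_minus_commute power2_le_iff_abs_le)
qed

text \<open>While the orbit stays within \<open>\<rho>\<close> of \<open>xs\<close>, the score does
  not increase in any direction \<open>q - xs\<close>, so neither does the coupling. A small initial
  coupling therefore rules out a first exit.\<close>

lemma sharp_solution_stable:
  assumes xs: "xs \<in> X" and r: "0 < r"
    and conic: "\<And>x. x \<in> X \<Longrightarrow> x \<noteq> xs \<Longrightarrow> xs + (r / norm (x - xs)) *\<^sub>R (x - xs) \<in> X"
    and local: "0 < \<rho>" "\<And>x q. x \<in> X \<Longrightarrow> dist x xs < \<rho> \<Longrightarrow> q \<in> X \<Longrightarrow> v x \<bullet> (q - xs) \<le> 0"
    and e: "0 < e"
  obtains \<eta> where "0 < \<eta>"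
    "\<And>y t. solves y \<Longrightarrow> dist (Q (y 0)) xs < \<eta> \<Longrightarrow> 0 \<le> t \<Longrightarrow> dist (Q (y t)) xs < e"
proof -
  define \<delta> where "\<delta> = min e \<rho>"
  have \<delta>: "0 < \<delta>" "\<delta> \<le> e" "\<delta> \<le> \<rho>" using e local(1) by (auto simp: \<delta>_def)
  \<comment> \<open>The coupling is held at the level of distance \<open>\<delta> / 2\<close>,
    strictly inside the exit distance \<open>\<delta>\<close>.\<close>
  have "0 < K * (\<delta> / 2)\<^sup>2 / 2" using K_pos \<delta> by simp
  then obtain \<eta> where "0 < \<eta>" and small: "\<And>y q. dist (Q y) xs < \<eta> \<Longrightarrow> q \<in> X \<Longrightarrow>
      y \<bullet> (q - xs) - H q + H xs \<le> K * (\<delta> / 2)\<^sup>2 / 2"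
    using fenchel_coupling_small[OF xs r conic] by blast
  have "dist (Q (y t)) xs < \<delta>" if y: "solves y" and y0: "dist (Q (y 0)) xs < \<eta>" and t: "0 \<le> t" for y t
  proof (rule ccontr)
    assume far: "\<not> dist (Q (y t)) xs < \<delta>"
    define f where "f s = dist (Q (y s)) xs" for s
    \<comment> \<open>The least element of this compact set is the first exit time; before it the
      orbit is within \<open>\<delta> \<le> \<rho>\<close>.\<close>
    define S where "S = {s \<in> {0..t}. \<delta> \<le> f s}"
    have "continuous_on {0..t} f"
      unfolding f_def using continuous_on_orbit[OF y]
      by (intro continuous_intros) (auto intro: continuous_on_subset)
    then have "closed ({0..t} \<inter> f -` {\<delta>..})"
      by (rule continuous_closed_preimage) auto
    moreover have "{0..t} \<inter> f -` {\<delta>..} = S" by (auto simp: S_def)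
    ultimately have "closed S" by simp
    then have "compact S" by (simp add: compact_eq_bounded_closed) (auto simp: S_def intro: bounded_subset[of "{0..t}"])
    moreover have "t \<in> S" using far t by (simp add: S_def f_def)
    ultimately obtain \<tau> where \<tau>: "\<tau> \<in> S" "\<And>s. s \<in> S \<Longrightarrow> \<tau> \<le> s"
      using compact_attains_inf[of S] by blast
    have \<tau>0: "0 \<le> \<tau>" using \<tau>(1) by (simp add: S_def)
    have before: "dist (Q (y s)) xs < \<rho>" if "0 < s" "s < \<tau>" for s
    proof -
      have "s \<notin> S" using \<tau>(2)[of s] that by auto
      then show ?thesis using that \<tau>(1) \<delta> by (auto simp: S_def f_def)
    qed
    have "dist (Q (y \<tau>)) xs \<le> \<delta> / 2"
    proof (rule fenchel_coupling_controls_distance[OF xs])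
      fix q assume q: "q \<in> X"
      have "(y \<tau> - y 0) \<bullet> (q - xs) \<le> 0 * (\<tau> - 0)"
        using before \<tau>0 q by (intro solves_increment_le[OF y] local(2) Q_in) auto
      then show "y \<tau> \<bullet> (q - xs) - H q + H xs \<le> K * (\<delta> / 2)\<^sup>2 / 2"
        using small[OF y0 q] by (simp add: inner_diff_left)
    qed (use \<delta> in simp)
    moreover have "\<delta> \<le> dist (Q (y \<tau>)) xs" using \<tau>(1) by (simp add: S_def f_def)
    ultimately show False using \<delta> by simp
  qed
  then show thesis using \<delta> \<open>0 < \<eta>\<close> by (intro that[of \<eta>]) force+
qed

text \<open>Test the score increment against the direction \<open>x - xs\<close> of the final choice
  \<open>x\<close>. Sharpness holds along the whole orbit for this fixed direction and gives a drift
  of at most \<open>- c * norm (x - xs) * t\<close>, while optimality and the initial score bound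
  the increment below by \<open>- E\<close>.\<close>

lemma sharp_solution_attracts:
  assumes xs: "xs \<in> X" and c: "0 < c"
    and y: "solves y" and sharp: "\<And>t q. 0 \<le> t \<Longrightarrow> q \<in> X \<Longrightarrow> v (Q (y t)) \<bullet> (q - xs) \<le> - c * norm (q - xs)"
  shows "((\<lambda>t. Q (y t)) \<longlongrightarrow> xs) at_top"
proof -
  obtain C where C: "0 < C" "\<And>x. x \<in> X \<Longrightarrow> \<bar>H x\<bar> \<le> C" by (rule H_bounded) blast
  obtain D where D: "0 < D" "\<And>x y. x \<in> X \<Longrightarrow> y \<in> X \<Longrightarrow> norm (x - y) \<le> D" by (rule X_diameter) blast
  define E where "E = 2 * C + norm (y 0) * D"
  have bound: "dist (Q (y t)) xs \<le> E / c / t" if t: "0 < t" for t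
  proof -
    define x where "x = Q (y t)"
    have x: "x \<in> X" by (simp add: x_def Q_in)
    have "(y t - y 0) \<bullet> (x - xs) \<le> - c * norm (x - xs) * (t - 0)"
      using t x by (intro solves_increment_le[OF y] sharp) auto
    moreover have "- (2 * C) \<le> y t \<bullet> (x - xs)"
      using Q_max[OF xs, of "y t"] C(2)[OF xs] C(2)[OF x]
      unfolding inner_diff_right x_def by linarith
    moreover have "y 0 \<bullet> (x - xs) \<le> norm (y 0) * D"
      using norm_cauchy_schwarz[of "y 0" "x - xs"] D(2)[OF x xs]
      by (meson mult_left_mono norm_ge_zero order_trans)
    ultimately have "c * norm (x - xs) * t \<le> E" by (simp add: E_def inner_diff_left)
    then show ?thesis using c t by (simp add: x_def dist_norm field_simps)
  qed
  have "((\<lambda>t. E / c / t) \<longlongrightarrow> 0) at_top"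
    by (intro tendsto_divide_0[OF tendsto_const] filterlim_at_top_imp_at_infinity filterlim_ident)
  then have "((\<lambda>t. dist (Q (y t)) xs) \<longlongrightarrow> 0) at_top"
    by (rule Lim_null_comparison[rotated])
       (use bound in \<open>auto intro!: eventually_mono[OF eventually_gt_at_top[of 0]]\<close>)
  then show ?thesis by (rule tendsto_dist_iff[THEN iffD2])
qed

end

section \<open>Finite games\<close>

lemma norm_vec_le_sum_norm: "norm (x :: 'b::real_normed_vector ^ 'n::finite) \<le> (\<Sum>i\<in>UNIV. norm (x $ i))"
  unfolding norm_vec_def by (rule L2_set_le_sum) simp

lemma norm_vec_power2: "(norm (x :: 'b::real_inner ^ 'n::finite))\<^sup>2 = (\<Sum>i\<in>UNIV. (norm (x $ i))\<^sup>2)"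
  by (simp add: power2_norm_eq_inner inner_vec_def)

lemma strategies_le_one:
  assumes "p \<in> strategies S" shows "p $ \<alpha> \<le> 1"
proof (cases "\<alpha> \<in> S")
  case True
  then have "p $ \<alpha> \<le> (\<Sum>\<beta>\<in>S. p $ \<beta>)"
    using assms by (intro member_le_sum) (auto simp: strategies_def)
  then show ?thesis using assms by (simp add: strategies_def)
qed (use assms in \<open>simp add: strategies_def\<close>)

lemma convex_strategies: "convex (strategies S)"
  by (intro convexI) (auto simp: strategies_def sum.distrib simp flip: sum_distrib_left)

lemma compact_strategies: "compact (strategies S :: (real^'a::finite) set)"
proof -
  have "norm p \<le> real CARD('a)" if "p \<in> strategies S" for p :: "real^'a"
  proof -
    have "\<bar>p $ \<alpha>\<bar> \<le> 1" for \<alpha>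
      using that strategies_le_one[OF that, of \<alpha>] by (simp add: strategies_def)
    then have "(\<Sum>\<alpha>\<in>UNIV. \<bar>p $ \<alpha>\<bar>) \<le> (\<Sum>\<alpha>\<in>(UNIV::'a set). 1)" by (intro sum_mono)
    then show ?thesis using norm_le_l1_cart[of p] by simp
  qed
  then have "bounded (strategies S :: (real^'a) set)" by (intro boundedI)
  moreover have "closed (strategies S :: (real^'a) set)"
    unfolding strategies_def
    by (intro closed_Collect_conj closed_Collect_all closed_Collect_imp closed_Collect_le
        closed_Collect_eq open_Collect_const continuous_intros)
  ultimately show ?thesis by (simp add: compact_eq_bounded_closed)
qed

lemma pure_in_strategies: "\<alpha> \<in> S \<Longrightarrow> pure \<alpha> \<in> strategies S"
  by (auto simp: strategies_def pure_def)

lemma convex_profiles: "convex (profiles A)"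
  by (intro convexI) (auto simp: profiles_def intro: convexD[OF convex_strategies])

lemma compact_profiles: "compact (profiles A :: (real^'a::finite^'n::finite) set)"
proof -
  have "\<exists>B. \<forall>p\<in>strategies (A k). norm p \<le> B" for k
    using compact_imp_bounded[OF compact_strategies] unfolding bounded_iff by blast
  then obtain B where B: "\<And>k p. p \<in> strategies (A k) \<Longrightarrow> norm p \<le> B k" by metis
  have "norm x \<le> (\<Sum>k\<in>UNIV. B k)" if "x \<in> profiles A" for x
  proof -
    have "norm (x $ k) \<le> B k" for k using that by (intro B) (simp add: profiles_def)
    then show ?thesis by (rule order_trans[OF norm_vec_le_sum_norm sum_mono])
  qed
  then have "bounded (profiles A)" by (intro boundedI)
  moreover have "closed (profiles A)"
  proof -
    have "profiles A = (\<Inter>k. (\<lambda>x. x $ k) -` strategies (A k))" by (auto simp: profiles_def)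
    moreover have "closed ((\<lambda>x :: real^'a^'n. x $ k) -` strategies (A k))" for k
      by (intro continuous_closed_vimage compact_imp_closed compact_strategies continuous_intros)
    ultimately show ?thesis by auto
  qed
  ultimately show ?thesis by (simp add: compact_eq_bounded_closed)
qed

lemma profiles_nonneg: "x \<in> profiles A \<Longrightarrow> 0 \<le> x $ k $ \<alpha>"
  by (simp add: profiles_def strategies_def)

lemma profiles_le_one: "x \<in> profiles A \<Longrightarrow> x $ k $ \<alpha> \<le> 1"
  using strategies_le_one[of "x $ k" "A k"] by (simp add: profiles_def)

lemma deviate_nth [simp]: "deviate x k p $ j = (if j = k then p else x $ j)"
  by (simp add: deviate_def)

lemma deviate_same [simp]: "deviate x k (x $ k) = x"
  by (simp add: vec_eq_iff)

lemma deviate_in_profiles: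
  "x \<in> profiles A \<Longrightarrow> p \<in> strategies (A k) \<Longrightarrow> deviate x k p \<in> profiles A"
  by (simp add: profiles_def)

section \<open>Payoffs and variational characterisation of equilibria\<close>

text \<open>Multilinearity: once the opponents' factor \<open>R\<close> is split off, the payoff is
  linear in \<open>p\<close>, and \<open>p\<close> decomposes into pure strategies. Coordinates
  outside \<open>A k\<close> drop out because \<open>p\<close> vanishes there.\<close>

lemma payoff_deviate_eq_inner:
  fixes A :: "'n::finite \<Rightarrow> 'a::finite set"
  assumes p: "\<And>\<alpha>. \<alpha> \<notin> A k \<Longrightarrow> p $ \<alpha> = 0"
  shows "payoff A pay k (deviate x k p) = payvec A pay x $ k \<bullet> p"
proof -
  define R where "R \<sigma> = (\<Prod>j\<in>UNIV - {k}. x $ j $ (\<sigma> j))" for \<sigma> :: "'n \<Rightarrow> 'a"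
  have dev: "payoff A pay k (deviate x k q) = (\<Sum>\<sigma>\<in>PiE UNIV A. pay k \<sigma> * R \<sigma> * q $ (\<sigma> k))" for q
  proof -
    have "(\<Prod>j\<in>UNIV. deviate x k q $ j $ (\<sigma> j)) = q $ (\<sigma> k) * R \<sigma>" for \<sigma>
      unfolding R_def by (subst prod.remove[of UNIV k]) auto
    then show ?thesis by (simp add: payoff_def mult_ac)
  qed
  have "payvec A pay x $ k \<bullet> p = (\<Sum>\<alpha>\<in>UNIV. payoff A pay k (deviate x k (pure \<alpha>)) * p $ \<alpha>)"
    unfolding inner_vec_def by (intro sum.cong) (auto simp: payvec_def p)
  also have "\<dots> = (\<Sum>\<alpha>\<in>UNIV. \<Sum>\<sigma>\<in>PiE UNIV A. pay k \<sigma> * R \<sigma> * (pure \<alpha> $ (\<sigma> k) * p $ \<alpha>))"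
    by (simp only: dev sum_distrib_right mult.assoc)
  also have "\<dots> = (\<Sum>\<sigma>\<in>PiE UNIV A. \<Sum>\<alpha>\<in>UNIV. pay k \<sigma> * R \<sigma> * (pure \<alpha> $ (\<sigma> k) * p $ \<alpha>))"
    by (rule sum.swap)
  also have "\<dots> = (\<Sum>\<sigma>\<in>PiE UNIV A. pay k \<sigma> * R \<sigma> * p $ (\<sigma> k))"
    by (simp add: pure_def if_distrib[of "\<lambda>u. u * _"] cong: if_cong flip: sum_distrib_left)
  finally show ?thesis by (simp add: dev)
qed

lemma payoff_deviate_diff:
  assumes x: "x \<in> profiles A" and p: "p \<in> strategies (A k)"
  shows "payoff A pay k (deviate x k p) - payoff A pay k x = payvec A pay x $ k \<bullet> (p - x $ k)"
proof -
  have "payoff A pay k (deviate x k q) = payvec A pay x $ k \<bullet> q" if "q \<in> strategies (A k)" for q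
    using that by (intro payoff_deviate_eq_inner) (simp add: strategies_def)
  from this[OF p] this[of "x $ k"] show ?thesis
    using x by (simp add: profiles_def inner_diff_right)
qed

text \<open>Summing the players' inequalities gives one direction. For the other, a unilateral
  deviation as test point leaves only the term of the deviating player.\<close>

lemma nash_iff_variational:
  assumes x: "x \<in> profiles A"
  shows "nash A pay x \<longleftrightarrow> (\<forall>q\<in>profiles A. payvec A pay x \<bullet> (q - x) \<le> 0)"
proof
  assume n: "nash A pay x"
  show "\<forall>q\<in>profiles A. payvec A pay x \<bullet> (q - x) \<le> 0"
  proof
    fix q assume "q \<in> profiles A"
    then have q: "q $ k \<in> strategies (A k)" for k by (simp add: profiles_def)
    have "payoff A pay k (deviate x k (q $ k)) \<le> payoff A pay k x" for k
      using n q[of k] unfolding nash_def by blast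
    then have "payvec A pay x $ k \<bullet> (q $ k - x $ k) \<le> 0" for k
      unfolding payoff_deviate_diff[OF x q, symmetric] by simp
    then show "payvec A pay x \<bullet> (q - x) \<le> 0"
      by (simp add: inner_vec_def[of "payvec A pay x"] sum_nonpos)
  qed
next
  assume vi: "\<forall>q\<in>profiles A. payvec A pay x \<bullet> (q - x) \<le> 0"
  have "payoff A pay k (deviate x k p) \<le> payoff A pay k x" if p: "p \<in> strategies (A k)" for k p
  proof -
    have "payvec A pay x \<bullet> (deviate x k p - x) =
        (\<Sum>j\<in>UNIV. if j = k then payvec A pay x $ k \<bullet> (p - x $ k) else 0)"
      unfolding inner_vec_def[of "payvec A pay x"] by (intro sum.cong) auto
    then have "payvec A pay x $ k \<bullet> (p - x $ k) \<le> 0"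
      using vi deviate_in_profiles[OF x p] by auto
    then show ?thesis using payoff_deviate_diff[OF x p, of pay] by simp
  qed
  then show "nash A pay x" using x by (simp add: nash_def)
qed

text \<open>Players who move lose strictly, players who stay contribute zero, and at least one
  player moves.\<close>

lemma strict_nash_imp_variational:
  fixes A :: "'n::finite \<Rightarrow> 'a::finite set"
  assumes n: "strict_nash A pay x" and q: "q \<in> profiles A" "q \<noteq> x"
  shows "payvec A pay x \<bullet> (q - x) < 0"
proof -
  have x: "x \<in> profiles A" using n by (simp add: strict_nash_def)
  have qk: "q $ k \<in> strategies (A k)" for k using q by (simp add: profiles_def)
  have lt: "payvec A pay x $ k \<bullet> (q $ k - x $ k) < 0" if "q $ k \<noteq> x $ k" for k
  proof -
    have "payoff A pay k (deviate x k (q $ k)) < payoff A pay k x"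
      using n qk[of k] that unfolding strict_nash_def by blast
    then show ?thesis unfolding payoff_deviate_diff[OF x qk, symmetric] by simp
  qed
  obtain k where k: "q $ k \<noteq> x $ k" using q(2) by (auto simp: vec_eq_iff)
  have "(\<Sum>k\<in>UNIV. payvec A pay x $ k \<bullet> (q $ k - x $ k)) < (\<Sum>k\<in>(UNIV::'n set). 0)"
  proof (rule sum_strict_mono_ex1)
    show "\<forall>k\<in>UNIV. payvec A pay x $ k \<bullet> (q $ k - x $ k) \<le> 0"
      using lt by (metis diff_self inner_zero_right order_less_imp_le order_refl)
  qed (use lt[OF k] in auto)
  then show ?thesis by (simp add: inner_vec_def[of "payvec A pay x"])
qed

text \<open>Products of factors in the unit interval differ by at most the sum of the differences of
  their factors, and each factor moves by at most \<open>norm (x - x')\<close>.\<close>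

lemma payvec_lipschitz:
  fixes A :: "'n::finite \<Rightarrow> 'a::finite set"
  obtains L where "0 < L"
    "\<And>x x'. x \<in> profiles A \<Longrightarrow> x' \<in> profiles A \<Longrightarrow>
      norm (payvec A pay x - payvec A pay x') \<le> L * norm (x - x')"
proof -
  define M where "M k = (\<Sum>\<sigma>\<in>PiE UNIV A. \<bar>pay k \<sigma>\<bar> * real CARD('n))" for k
  \<comment> \<open>The summand \<open>1\<close> keeps the constant positive even when all payoffs
    vanish.\<close>
  define L where "L = (\<Sum>k\<in>UNIV. \<Sum>\<alpha>\<in>(UNIV::'a set). M k) + 1"
  have M: "0 \<le> M k" for k by (simp add: M_def sum_nonneg)
  have entry: "\<bar>payoff A pay k (deviate x k (pure \<alpha>)) - payoff A pay k (deviate x' k (pure \<alpha>))\<bar>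
      \<le> M k * norm (x - x')" if "x \<in> profiles A" "x' \<in> profiles A" for x x' k \<alpha>
  proof -
    have comp: "\<bar>deviate x k (pure \<alpha>) $ j $ a\<bar> \<le> 1" if "x \<in> profiles A" for x j a
      using profiles_nonneg[OF that, of j a] profiles_le_one[OF that, of j a] by (simp add: pure_def)
    have "\<bar>(\<Prod>j\<in>UNIV. deviate x k (pure \<alpha>) $ j $ (\<sigma> j)) - (\<Prod>j\<in>UNIV. deviate x' k (pure \<alpha>) $ j $ (\<sigma> j))\<bar>
        \<le> real CARD('n) * norm (x - x')" for \<sigma>
    proof -
      have "\<bar>(\<Prod>j\<in>UNIV. deviate x k (pure \<alpha>) $ j $ (\<sigma> j)) - (\<Prod>j\<in>UNIV. deviate x' k (pure \<alpha>) $ j $ (\<sigma> j))\<bar>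
          \<le> (\<Sum>j\<in>UNIV. \<bar>deviate x k (pure \<alpha>) $ j $ (\<sigma> j) - deviate x' k (pure \<alpha>) $ j $ (\<sigma> j)\<bar>)"
        using comp that
        by (intro norm_prod_diff[where 'a = real, unfolded real_norm_def]) auto
      also have "\<dots> \<le> (\<Sum>j\<in>(UNIV::'n set). norm (x - x'))"
      proof (rule sum_mono)
        fix j
        have "\<bar>(x - x') $ j $ (\<sigma> j)\<bar> \<le> norm (x - x')"
          by (rule order_trans[OF component_le_norm_cart Finite_Cartesian_Product.norm_nth_le])
        then show "\<bar>deviate x k (pure \<alpha>) $ j $ (\<sigma> j) - deviate x' k (pure \<alpha>) $ j $ (\<sigma> j)\<bar> \<le> norm (x - x')"
          by simp
      qed
      finally show ?thesis by simp
    qed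
    then have "(\<Sum>\<sigma>\<in>PiE UNIV A. \<bar>pay k \<sigma>\<bar> * \<bar>(\<Prod>j\<in>UNIV. deviate x k (pure \<alpha>) $ j $ (\<sigma> j)) -
        (\<Prod>j\<in>UNIV. deviate x' k (pure \<alpha>) $ j $ (\<sigma> j))\<bar>) \<le> M k * norm (x - x')"
      unfolding M_def sum_distrib_right mult.assoc by (intro sum_mono mult_left_mono) auto
    moreover have "payoff A pay k (deviate x k (pure \<alpha>)) - payoff A pay k (deviate x' k (pure \<alpha>)) =
        (\<Sum>\<sigma>\<in>PiE UNIV A. pay k \<sigma> * ((\<Prod>j\<in>UNIV. deviate x k (pure \<alpha>) $ j $ (\<sigma> j)) -
        (\<Prod>j\<in>UNIV. deviate x' k (pure \<alpha>) $ j $ (\<sigma> j))))"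
      by (simp only: payoff_def sum_subtractf right_diff_distrib)
    ultimately show ?thesis
      using sum_abs[of "\<lambda>\<sigma>. pay k \<sigma> * ((\<Prod>j\<in>UNIV. deviate x k (pure \<alpha>) $ j $ (\<sigma> j)) -
        (\<Prod>j\<in>UNIV. deviate x' k (pure \<alpha>) $ j $ (\<sigma> j)))" "PiE UNIV A"]
      by (simp only: abs_mult)
  qed
  show thesis
  proof (rule that[of L])
    show "0 < L" unfolding L_def using M by (intro add_nonneg_pos sum_nonneg) auto
    fix x x' assume x: "x \<in> profiles A" "x' \<in> profiles A"
    define w where "w = payvec A pay x - payvec A pay x'"
    have "\<bar>w $ k $ \<alpha>\<bar> \<le> M k * norm (x - x')" for k \<alpha>
      using entry[OF x, of k \<alpha>] M by (simp add: w_def payvec_def)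
    then have "norm (w $ k) \<le> (\<Sum>\<alpha>\<in>(UNIV::'a set). M k * norm (x - x'))" for k
      by (intro order_trans[OF norm_le_l1_cart] sum_mono)
    then have "norm w \<le> (\<Sum>k\<in>UNIV. \<Sum>\<alpha>\<in>(UNIV::'a set). M k * norm (x - x'))"
      by (rule order_trans[OF norm_vec_le_sum_norm sum_mono])
    also have "\<dots> = (\<Sum>k\<in>UNIV. \<Sum>\<alpha>\<in>(UNIV::'a set). M k) * norm (x - x')"
      by (simp only: sum_distrib_right)
    also have "\<dots> \<le> L * norm (x - x')" unfolding L_def by (intro mult_right_mono) auto
    finally show "norm (payvec A pay x - payvec A pay x') \<le> L * norm (x - x')" by (simp add: w_def)
  qed
qed

section \<open>The game as an instance of regularised learning\<close>

text \<open>Justifies the definite description in \<open>choice\<close>: compactness gives a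
  maximiser, and by strong convexity the midpoint of two distinct ones would do better.\<close>

lemma choice_maximises:
  assumes "S \<noteq> {}" and pen: "penalty S h"
  shows "choice S h y \<in> strategies S \<and>
    (\<forall>q\<in>strategies S. y \<bullet> q - h q \<le> y \<bullet> choice S h y - h (choice S h y))"
  unfolding choice_def
proof (rule theI')
  obtain K where K: "0 < K" and strong: "\<And>p q t. p \<in> strategies S \<Longrightarrow> q \<in> strategies S \<Longrightarrow> t \<in> {0..1} \<Longrightarrow>
      h (t *\<^sub>R p + (1 - t) *\<^sub>R q) \<le> t * h p + (1 - t) * h q - K * t * (1 - t) * (norm (p - q))\<^sup>2 / 2"
    using pen unfolding penalty_def strongly_convex_on_def by blast
  have "continuous_on (strategies S) (\<lambda>q. y \<bullet> q - h q)"
    using pen unfolding penalty_def by (intro continuous_intros) auto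
  moreover have "strategies S \<noteq> {}" using \<open>S \<noteq> {}\<close> pure_in_strategies by blast
  ultimately obtain p where p: "p \<in> strategies S" "\<forall>q\<in>strategies S. y \<bullet> q - h q \<le> y \<bullet> p - h p"
    using continuous_attains_sup[OF compact_strategies] by blast
  show "\<exists>!p. p \<in> strategies S \<and> (\<forall>q\<in>strategies S. y \<bullet> q - h q \<le> y \<bullet> p - h p)"
  proof (rule ex1I[of _ p])
    fix q assume q: "q \<in> strategies S \<and> (\<forall>r\<in>strategies S. y \<bullet> r - h r \<le> y \<bullet> q - h q)"
    define m where "m = (1/2) *\<^sub>R p + (1 - 1/2) *\<^sub>R q"
    have "m \<in> strategies S"
      unfolding m_def using p q by (intro convexD[OF convex_strategies]) auto
    then have "y \<bullet> m - h m \<le> y \<bullet> p - h p" using p by blast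
    moreover have "y \<bullet> m = (y \<bullet> p + y \<bullet> q) / 2" by (simp add: m_def inner_add_right)
    moreover have "h m \<le> h p / 2 + h q / 2 - K * (norm (p - q))\<^sup>2 / 8"
      using strong[of p q "1/2"] p q by (simp add: m_def)
    moreover have "y \<bullet> q - h q = y \<bullet> p - h p" using p q by (meson antisym)
    ultimately have "K * (norm (p - q))\<^sup>2 \<le> 0" by argo
    then show "q = p" using K by (simp add: mult_le_0_iff)
  qed (use p in blast)
qed

lemma game_regularized_learning:
  fixes A :: "'n::finite \<Rightarrow> 'a::finite set"
  assumes nonempty: "\<forall>k. A k \<noteq> {}" and pen: "\<forall>k. penalty (A k) (h k)"
  shows "\<exists>H K L. regularized_learning (profiles A) H K L (Qmap A h) (payvec A pay)"
proof -
  obtain L where L: "0 < L" "\<And>x x'. x \<in> profiles A \<Longrightarrow> x' \<in> profiles A \<Longrightarrow>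
      norm (payvec A pay x - payvec A pay x') \<le> L * norm (x - x')"
    by (rule payvec_lipschitz) blast
  have "\<forall>k. \<exists>K>0. \<forall>p\<in>strategies (A k). \<forall>q\<in>strategies (A k). \<forall>t\<in>{0..1}.
      h k (t *\<^sub>R p + (1 - t) *\<^sub>R q) \<le> t * h k p + (1 - t) * h k q - K * t * (1 - t) * (norm (p - q))\<^sup>2 / 2"
    using pen unfolding penalty_def strongly_convex_on_def by blast
  then obtain \<kappa> where \<kappa>: "\<And>k. 0 < \<kappa> k"
    "\<And>k p q t. p \<in> strategies (A k) \<Longrightarrow> q \<in> strategies (A k) \<Longrightarrow> t \<in> {0..1} \<Longrightarrow>
      h k (t *\<^sub>R p + (1 - t) *\<^sub>R q) \<le> t * h k p + (1 - t) * h k q - \<kappa> k * t * (1 - t) * (norm (p - q))\<^sup>2 / 2"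
    by metis
  \<comment> \<open>The smallest modulus serves all players together, because squared norms add up
    over the players.\<close>
  define K where "K = Min (range \<kappa>)"
  have K: "0 < K" "\<And>k. K \<le> \<kappa> k" using \<kappa>(1) by (auto simp: K_def)
  define H where "H x = (\<Sum>k\<in>UNIV. h k (x $ k))" for x :: "real^'a^'n"
  have Q: "Qmap A h y $ k \<in> strategies (A k)"
    "\<And>q. q \<in> strategies (A k) \<Longrightarrow> y $ k \<bullet> q - h k q \<le> y $ k \<bullet> (Qmap A h y $ k) - h k (Qmap A h y $ k)"
    for y k
    using choice_maximises[of "A k" "h k" "y $ k"] nonempty pen by (auto simp: Qmap_def)
  have "regularized_learning (profiles A) H K L (Qmap A h) (payvec A pay)"
  proof
    show "continuous_on (profiles A) H"
      unfolding H_def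
    proof (intro continuous_on_sum)
      fix k
      have "continuous_on (strategies (A k)) (h k)" using pen by (simp add: penalty_def)
      then show "continuous_on (profiles A) (\<lambda>x. h k (x $ k))"
        by (rule continuous_on_compose2) (auto intro!: continuous_intros simp: profiles_def)
    qed
    show "H (t *\<^sub>R p + (1 - t) *\<^sub>R q) \<le> t * H p + (1 - t) * H q - K * t * (1 - t) * (norm (p - q))\<^sup>2 / 2"
      if "p \<in> profiles A" "q \<in> profiles A" "0 \<le> t" "t \<le> 1" for p q t
    proof -
      have "H (t *\<^sub>R p + (1 - t) *\<^sub>R q) \<le> (\<Sum>k\<in>UNIV. t * h k (p $ k) + (1 - t) * h k (q $ k)
          - K * t * (1 - t) / 2 * (norm (p $ k - q $ k))\<^sup>2)"
        unfolding H_def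
      proof (rule sum_mono)
        fix k
        have "K * (t * (1 - t) / 2 * (norm (p $ k - q $ k))\<^sup>2)
            \<le> \<kappa> k * (t * (1 - t) / 2 * (norm (p $ k - q $ k))\<^sup>2)"
          using K that by (intro mult_right_mono) auto
        moreover have "h k (t *\<^sub>R p $ k + (1 - t) *\<^sub>R q $ k) \<le> t * h k (p $ k) + (1 - t) * h k (q $ k)
            - \<kappa> k * t * (1 - t) * (norm (p $ k - q $ k))\<^sup>2 / 2"
          using that by (intro \<kappa>(2)) (auto simp: profiles_def)
        ultimately show "h k ((t *\<^sub>R p + (1 - t) *\<^sub>R q) $ k) \<le> t * h k (p $ k) + (1 - t) * h k (q $ k)
          - K * t * (1 - t) / 2 * (norm (p $ k - q $ k))\<^sup>2"
          by (simp add: mult.assoc)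
      qed
      also have "\<dots> = t * H p + (1 - t) * H q - K * t * (1 - t) / 2 * (norm (p - q))\<^sup>2"
        unfolding H_def norm_vec_power2
        by (simp only: sum.distrib sum_subtractf sum_distrib_left vector_minus_component)
      finally show ?thesis by simp
    qed
    show "Qmap A h y \<in> profiles A" for y using Q(1) by (simp add: profiles_def)
    show "y \<bullet> q - H q \<le> y \<bullet> Qmap A h y - H (Qmap A h y)" if "q \<in> profiles A" for y q
    proof -
      have "(\<Sum>k\<in>UNIV. y $ k \<bullet> q $ k - h k (q $ k))
          \<le> (\<Sum>k\<in>UNIV. y $ k \<bullet> Qmap A h y $ k - h k (Qmap A h y $ k))"
        using that by (intro sum_mono Q(2)) (simp add: profiles_def)
      then show ?thesis by (simp add: H_def inner_vec_def[of y] sum_subtractf)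
    qed
  qed (use K L compact_profiles convex_profiles in auto)
  then show ?thesis by blast
qed

text \<open>On the ray from \<open>xs\<close> through \<open>x\<close>, coordinates that vanish at
  \<open>xs\<close> cannot decrease. The others lose at most \<open>r\<close>, which is no larger
  than any positive coordinate of \<open>xs\<close>, and the affine constraints persist.\<close>

lemma profiles_conic:
  fixes A :: "'n::finite \<Rightarrow> 'a::finite set"
  assumes xs: "xs \<in> profiles A"
  obtains r where "0 < r"
    "\<And>x. x \<in> profiles A \<Longrightarrow> x \<noteq> xs \<Longrightarrow> xs + (r / norm (x - xs)) *\<^sub>R (x - xs) \<in> profiles A"
proof -
  define P where "P = insert 1 {xs $ k $ \<alpha> | k \<alpha>. 0 < xs $ k $ \<alpha>}"
  have "finite P"
  proof -
    have "P \<subseteq> insert 1 ((\<lambda>(k, \<alpha>). xs $ k $ \<alpha>) ` UNIV)" by (auto simp: P_def)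
    then show ?thesis by (rule finite_subset) simp
  qed
  define r where "r = Min P"
  have r: "0 < r" unfolding r_def using \<open>finite P\<close> by (subst Min_gr_iff) (auto simp: P_def)
  have r_le: "r \<le> xs $ k $ \<alpha>" if "0 < xs $ k $ \<alpha>" for k \<alpha>
    unfolding r_def using \<open>finite P\<close> that by (intro Min_le) (auto simp: P_def)
  show thesis
  proof (rule that[OF r])
    fix x assume x: "x \<in> profiles A" and "x \<noteq> xs"
    define s where "s = r / norm (x - xs)"
    have s: "0 < s" using r \<open>x \<noteq> xs\<close> by (simp add: s_def)
    have "0 \<le> xs $ k $ \<alpha> + s * (x $ k $ \<alpha> - xs $ k $ \<alpha>)" for k \<alpha>
    proof (cases "xs $ k $ \<alpha> = 0")
      case True
      then show ?thesis using s profiles_nonneg[OF x] by simp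
    next
      case False
      then have "r \<le> xs $ k $ \<alpha>" using profiles_nonneg[OF xs, of k \<alpha>] by (intro r_le) simp
      moreover have "\<bar>(x - xs) $ k $ \<alpha>\<bar> \<le> norm (x - xs)"
        by (rule order_trans[OF component_le_norm_cart Finite_Cartesian_Product.norm_nth_le])
      then have "s * \<bar>(x - xs) $ k $ \<alpha>\<bar> \<le> s * norm (x - xs)"
        using s by (intro mult_left_mono) auto
      then have "\<bar>s * (x $ k $ \<alpha> - xs $ k $ \<alpha>)\<bar> \<le> r"
        using r \<open>x \<noteq> xs\<close> by (simp add: abs_mult s_def)
      ultimately show ?thesis by linarith
    qed
    moreover have "(\<Sum>\<alpha>\<in>A k. xs $ k $ \<alpha> + s * (x $ k $ \<alpha> - xs $ k $ \<alpha>)) = 1" for k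
    proof -
      have "(\<Sum>\<alpha>\<in>A k. x $ k $ \<alpha>) = 1" "(\<Sum>\<alpha>\<in>A k. xs $ k $ \<alpha>) = 1"
        using x xs by (auto simp: profiles_def strategies_def)
      then show ?thesis by (simp add: sum.distrib sum_subtractf flip: sum_distrib_left)
    qed
    moreover have "x $ k $ \<alpha> = 0" "xs $ k $ \<alpha> = 0" if "\<alpha> \<notin> A k" for k \<alpha>
      using x xs that by (auto simp: profiles_def strategies_def)
    ultimately show "xs + (r / norm (x - xs)) *\<^sub>R (x - xs) \<in> profiles A"
      unfolding s_def[symmetric] by (simp add: profiles_def strategies_def)
  qed
qed

lemma openin_contains_dist_ball:
  assumes "openin (top_of_set X) U" "x \<in> U"
  obtains e where "0 < e" "\<And>z. z \<in> X \<Longrightarrow> dist z x < e \<Longrightarrow> z \<in> U"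
  using assms unfolding openin_euclidean_subtopology_iff by blast

section \<open>The stability claims for the game\<close>

theorem theorem5p1:
  fixes A :: "'n::finite \<Rightarrow> 'a::finite set"
    and pay :: "'n \<Rightarrow> ('n \<Rightarrow> 'a) \<Rightarrow> real"
    and h :: "'n \<Rightarrow> real^'a \<Rightarrow> real"
    and xs :: "real^'a^'n"
  assumes nonempty: "\<forall>k. A k \<noteq> {}"
    and pen: "\<forall>k. penalty (A k) (h k)"
    and xs_in: "xs \<in> profiles A"
  shows "(stationary A pay h xs \<longrightarrow> nash A pay xs)
     \<and> (nash A pay xs \<and> xs \<in> range (Qmap A h) \<longrightarrow> stationary A pay h xs)
     \<and> (\<forall>y. is_solution A pay h y \<and> ((\<lambda>t. Qmap A h (y t)) \<longlongrightarrow> xs) at_top \<longrightarrow> nash A pay xs)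
     \<and> (lyapunov_stable A pay h xs \<longrightarrow> nash A pay xs)
     \<and> (strict_nash A pay xs \<longrightarrow> asymptotically_stable A pay h xs)"
proof -
  obtain H K L where "regularized_learning (profiles A) H K L (Qmap A h) (payvec A pay)"
    using game_regularized_learning[OF nonempty pen] by blast
  then interpret regularized_learning "profiles A" H K L "Qmap A h" "payvec A pay" .
  have solves_iff: "solves y \<longleftrightarrow> is_solution A pay h y" for y
    by (simp add: solves_def is_solution_def)
  have orbitI: "is_orbit A pay h (\<lambda>t. Qmap A h (y t))" if "solves y" for y
    using that unfolding is_orbit_def solves_iff by blast
  have orbitE: "\<exists>y. solves y \<and> (\<forall>t\<ge>0. x t = Qmap A h (y t))" if "is_orbit A pay h x" for x
    using that unfolding is_orbit_def solves_iff by blast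
  have nash_iff: "nash A pay xs \<longleftrightarrow> variational_solution xs"
    using nash_iff_variational[OF xs_in] by (simp add: variational_solution_def)
  have nashI: "nash A pay xs"
    if "\<And>e. 0 < e \<Longrightarrow> \<exists>y T. solves y \<and> 0 \<le> T \<and> (\<forall>t\<ge>T. dist (Qmap A h (y t)) xs < e)"
    unfolding nash_iff using xs_in that by (rule trapped_orbits_imp_variational_solution)

  have "nash A pay xs" if st: "stationary A pay h xs"
  proof (rule nashI)
    fix e :: real assume e: "0 < e"
    obtain y0 where y0: "xs = Qmap A h y0" using st unfolding stationary_def by blast
    \<comment> \<open>Stationarity quantifies over all orbits through \<open>xs\<close>; global
      existence supplies one to which it applies.\<close>
    obtain y where y: "solves y" "y 0 = y0" by (rule solution_exists)
    have "\<forall>t\<ge>0. Qmap A h (y t) = xs"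
      using st[unfolded stationary_def, THEN conjunct2, THEN spec, of "\<lambda>t. Qmap A h (y t)"]
        orbitI[OF y(1)] y(2) y0 by simp
    then show "\<exists>y T. solves y \<and> 0 \<le> T \<and> (\<forall>t\<ge>T. dist (Qmap A h (y t)) xs < e)"
      using y e by (intro exI[of _ y] exI[of _ 0]) auto
  qed
  moreover have "stationary A pay h xs" if "nash A pay xs" "xs \<in> range (Qmap A h)"
    unfolding stationary_def
  proof (intro conjI allI impI that(2))
    fix x and t :: real assume x: "is_orbit A pay h x \<and> x 0 = xs" and t: "0 \<le> t"
    then obtain y where y: "solves y" "\<And>t. 0 \<le> t \<Longrightarrow> x t = Qmap A h (y t)"
      using orbitE[of x] by blast
    have "Qmap A h (y 0) = xs" using x y(2)[of 0] by simp
    then have "Qmap A h (y t) = xs"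
      using variational_solution_imp_constant_orbit[OF _ y(1) _ t] that(1) nash_iff by blast
    then show "x t = xs" using y(2)[OF t] by simp
  qed
  moreover have "nash A pay xs"
    if y: "is_solution A pay h y" and lim: "((\<lambda>t. Qmap A h (y t)) \<longlongrightarrow> xs) at_top" for y
  proof (rule nashI)
    fix e :: real assume "0 < e"
    then obtain T where T: "\<forall>t\<ge>T. dist (Qmap A h (y t)) xs < e"
      using tendstoD[OF lim] unfolding eventually_at_top_linorder by blast
    \<comment> \<open>The threshold taken from the limit may be negative, hence
      \<open>max 0 T\<close>.\<close>
    then show "\<exists>y T. solves y \<and> 0 \<le> T \<and> (\<forall>t\<ge>T. dist (Qmap A h (y t)) xs < e)"
      using y unfolding solves_iff by (intro exI[of _ y] exI[of _ "max 0 T"]) auto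
  qed
  moreover have "nash A pay xs" if st: "lyapunov_stable A pay h xs"
  proof (rule nashI)
    fix e :: real assume e: "0 < e"
    have "openin (top_of_set (profiles A)) (profiles A \<inter> ball xs e)" "xs \<in> profiles A \<inter> ball xs e"
      using xs_in e by (auto simp: openin_open_Int)
    then obtain V where V: "openin (top_of_set (profiles A)) V" "xs \<in> V"
      "\<And>x. is_orbit A pay h x \<Longrightarrow> x 0 \<in> V \<inter> range (Qmap A h) \<Longrightarrow> \<forall>t\<ge>0. x t \<in> profiles A \<inter> ball xs e"
      using st unfolding lyapunov_stable_def by meson
    obtain \<eta> where \<eta>: "0 < \<eta>" "\<And>z. z \<in> profiles A \<Longrightarrow> dist z xs < \<eta> \<Longrightarrow> z \<in> V"
      by (rule openin_contains_dist_ball[OF V(1,2)]) blast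
    \<comment> \<open>The point \<open>xs\<close> may lie outside the image of \<open>Q\<close>, so
      an orbit starting in \<open>V\<close> comes from density of the image.\<close>
    obtain y0 where y0: "dist (Qmap A h y0) xs < \<eta>" using range_Q_dense[OF xs_in \<eta>(1)] by blast
    obtain y where y: "solves y" "y 0 = y0" by (rule solution_exists)
    have "\<forall>t\<ge>0. Qmap A h (y t) \<in> profiles A \<inter> ball xs e"
      using V(3)[OF orbitI[OF y(1)]] \<eta>(2)[OF Q_in y0] y(2) by blast
    then show "\<exists>y T. solves y \<and> 0 \<le> T \<and> (\<forall>t\<ge>T. dist (Qmap A h (y t)) xs < e)"
      using y by (intro exI[of _ y] exI[of _ 0]) (auto simp: dist_commute)
  qed
  moreover have "asymptotically_stable A pay h xs" if sn: "strict_nash A pay xs"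
  proof -
    obtain r where r: "0 < r"
      "\<And>x. x \<in> profiles A \<Longrightarrow> x \<noteq> xs \<Longrightarrow> xs + (r / norm (x - xs)) *\<^sub>R (x - xs) \<in> profiles A"
      by (rule profiles_conic[OF xs_in]) blast
    obtain c where c: "0 < c" "\<And>q. q \<in> profiles A \<Longrightarrow> payvec A pay xs \<bullet> (q - xs) \<le> - c * norm (q - xs)"
      by (rule strict_solution_sharp[OF r strict_nash_imp_variational[OF sn]]) blast+
    define \<rho> where "\<rho> = c / (2 * L)"
    have \<rho>: "0 < \<rho>" using c L_pos by (simp add: \<rho>_def)
    have sharp: "payvec A pay x \<bullet> (q - xs) \<le> - (c / 2) * norm (q - xs)"
      if "x \<in> profiles A" "dist x xs < \<rho>" "q \<in> profiles A" for x q
      using strict_solution_locally_sharp[OF xs_in c] that unfolding \<rho>_def by blast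
    then have nonpos: "payvec A pay x \<bullet> (q - xs) \<le> 0"
      if "x \<in> profiles A" "dist x xs < \<rho>" "q \<in> profiles A" for x q
      using that c(1) by (meson mult_nonpos_nonneg neg_le_0_iff_le half_gt_zero less_imp_le norm_ge_zero order_trans)
    have stable: "\<exists>V. openin (top_of_set (profiles A)) V \<and> xs \<in> V \<and>
        (\<forall>y. solves y \<longrightarrow> Qmap A h (y 0) \<in> V \<longrightarrow> (\<forall>t\<ge>0. dist (Qmap A h (y t)) xs < e))"
      if "0 < e" for e
    proof -
      obtain \<eta> where \<eta>: "0 < \<eta>" "\<And>y t. solves y \<Longrightarrow> dist (Qmap A h (y 0)) xs < \<eta> \<Longrightarrow> 0 \<le> t \<Longrightarrow>
          dist (Qmap A h (y t)) xs < e"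
        by (rule sharp_solution_stable[OF xs_in r \<rho> nonpos \<open>0 < e\<close>]) blast+
      show ?thesis
        using \<eta> xs_in by (intro exI[of _ "profiles A \<inter> ball xs \<eta>"])
          (auto simp: openin_open_Int dist_commute)
    qed
    have "lyapunov_stable A pay h xs"
      unfolding lyapunov_stable_def
    proof (intro allI impI)
      fix U assume U: "openin (top_of_set (profiles A)) U \<and> xs \<in> U"
      obtain e where e: "0 < e" "\<And>z. z \<in> profiles A \<Longrightarrow> dist z xs < e \<Longrightarrow> z \<in> U"
        by (rule openin_contains_dist_ball[of "profiles A" U xs]) (use U in blast)+
      obtain V where V: "openin (top_of_set (profiles A)) V" "xs \<in> V"
        "\<And>y t. solves y \<Longrightarrow> Qmap A h (y 0) \<in> V \<Longrightarrow> 0 \<le> t \<Longrightarrow> dist (Qmap A h (y t)) xs < e"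
        using stable[OF e(1)] by blast
      have "x t \<in> U" if "is_orbit A pay h x" "x 0 \<in> V" "0 \<le> t" for x t
      proof -
        obtain y where "solves y" "\<And>t. 0 \<le> t \<Longrightarrow> x t = Qmap A h (y t)"
          using orbitE[OF \<open>is_orbit A pay h x\<close>] by blast
        then show ?thesis using e(2)[OF Q_in] V(3)[of y t] that by simp
      qed
      then show "\<exists>V. openin (top_of_set (profiles A)) V \<and> xs \<in> V \<and>
          (\<forall>x. is_orbit A pay h x \<and> x 0 \<in> V \<inter> range (Qmap A h) \<longrightarrow> (\<forall>t\<ge>0. x t \<in> U))"
        using V(1,2) by blast
    qed
    moreover have "attracting A pay h xs"
    proof -
      \<comment> \<open>Stability at radius \<open>\<rho>\<close> confines the orbit for all times
        to the region where the sharp inequality holds.\<close>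
      obtain V where V: "openin (top_of_set (profiles A)) V" "xs \<in> V"
        "\<And>y t. solves y \<Longrightarrow> Qmap A h (y 0) \<in> V \<Longrightarrow> 0 \<le> t \<Longrightarrow> dist (Qmap A h (y t)) xs < \<rho>"
        using stable[OF \<rho>] by blast
      have "(x \<longlongrightarrow> xs) at_top" if "is_orbit A pay h x" "x 0 \<in> V" for x
      proof -
        obtain y where y: "solves y" "\<And>t. 0 \<le> t \<Longrightarrow> x t = Qmap A h (y t)"
          using orbitE[OF \<open>is_orbit A pay h x\<close>] by blast
        have "((\<lambda>t. Qmap A h (y t)) \<longlongrightarrow> xs) at_top"
        proof (rule sharp_solution_attracts[OF xs_in _ y(1)])
          show "0 < c / 2" using c by simp
          show "payvec A pay (Qmap A h (y t)) \<bullet> (q - xs) \<le> - (c / 2) * norm (q - xs)"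
            if "0 \<le> t" "q \<in> profiles A" for t q
            using that y(2)[of 0] \<open>x 0 \<in> V\<close> by (intro sharp Q_in V(3) y(1)) auto
        qed
        then show ?thesis
          \<comment> \<open>An orbit agrees with \<open>Qmap A h (y t)\<close> only at nonnegative
            times, which suffices for the limit.\<close>
          by (rule Lim_transform_eventually)
             (use y(2) in \<open>auto intro!: eventually_mono[OF eventually_ge_at_top[of 0]]\<close>)
      qed
      then show ?thesis unfolding attracting_def using V(1,2) by blast
    qed
    ultimately show ?thesis by (simp add: asymptotically_stable_def)
  qed
  ultimately show ?thesis by blast
qed

end
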